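(* Let $\mathbf{k}$ be an algebraically closed field of characteristic zero, and let $X$ be a normal toric affine variety over $\mathbf{k}$ with acting torus $\mathbb{T}$. Let $G$ be a group acting on $X$ and generated by a finite collection $U_1,\ldots,U_s$ of one-parameter unipotent subgroups of $\mathrm{Aut}(X)$ normalized by $\mathbb{T}$. If $G$ is doubly transitive on a $G$-orbit in $X$, then $G$ contains a free subgroup of rank two.
   Context: A toric affine variety $X$ of dimension $n$ is an affine variety equipped with an effective regular action of an algebraic torus $\mathbb{T}=(\mathbb{G}_m)^n$ having an open orbit, where $\mathbb{G}_m$ is the multiplicative group of $\mathbf{k}$. A one-parameter unipotent subgroup ($\mathbb{G}_a$-subgroup) of $\mathrm{Aut}(X)$ is the image in $\mathrm{Aut}(X)$ of the additive group $\mathbb{G}_a$ of $\mathbf{k}$ under an effective regular action $\mathbb{G}_a\times X\to X$; any such subgroup has the form $\{\exp(t\partial)\mid t\in\mathbf{k}\}$ with $\partial$ a locally nilpotent derivation of the structure ring $\mathcal{O}(X)$. A group acts doubly transitively (2-transitively) on a set if it acts transitively on the ordered pairs of distinct elements of that set. *)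

theory Defs
  imports
    "HOL-Computational_Algebra.Polynomial"
    "HOL-Algebra.Group_Action"
    "HOL-Algebra.Generated_Groups"
    "HOL-Algebra.Product_Groups"
begin

section \<open>Affine varieties over a field\<close>

text \<open>
  Varieties are irreducible Zariski closed subsets of an affine space \<open>k\<^sup>m\<close>, where \<open>k\<close> is the field
  underlying the type \<^typ>\<open>'k\<close> (algebraically closed in all uses). A point of \<open>k\<^sup>m\<close> is an
  extensional function on \<open>{..<m}\<close>, so that \<open>m\<close> can be any natural number, including \<open>0\<close>.
\<close>

definition affine_space :: "nat \<Rightarrow> (nat \<Rightarrow> 'k) set" where
  "affine_space m = {..<m} \<rightarrow>\<^sub>E UNIV"

text \<open>The \<open>k\<close>-algebra of functions generated by the functions in \<open>F\<close>.\<close>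

inductive_set function_algebra :: "('x \<Rightarrow> 'k::field) set \<Rightarrow> ('x \<Rightarrow> 'k) set"
  for F :: "('x \<Rightarrow> 'k) set" where
  const: "(\<lambda>_. c) \<in> function_algebra F"
| gen: "f \<in> F \<Longrightarrow> f \<in> function_algebra F"
| add: "f \<in> function_algebra F \<Longrightarrow> g \<in> function_algebra F \<Longrightarrow> (\<lambda>x. f x + g x) \<in> function_algebra F"
| mult: "f \<in> function_algebra F \<Longrightarrow> g \<in> function_algebra F \<Longrightarrow> (\<lambda>x. f x * g x) \<in> function_algebra F"

definition polynomial_functions :: "nat \<Rightarrow> ((nat \<Rightarrow> 'k::field) \<Rightarrow> 'k) set" where
  "polynomial_functions m = function_algebra ((\<lambda>j x. x j) ` {..<m})"

definition zariski_closed :: "nat \<Rightarrow> (nat \<Rightarrow> 'k::field) set \<Rightarrow> bool" where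
  "zariski_closed m Z \<longleftrightarrow>
    (\<exists>F \<subseteq> polynomial_functions m. Z = {x \<in> affine_space m. \<forall>f\<in>F. f x = 0})"

definition affine_variety :: "nat \<Rightarrow> (nat \<Rightarrow> 'k::field) set \<Rightarrow> bool" where
  "affine_variety m X \<longleftrightarrow> zariski_closed m X \<and> X \<noteq> {} \<and>
    (\<forall>Y Z. zariski_closed m Y \<and> zariski_closed m Z \<and> X \<subseteq> Y \<union> Z \<longrightarrow> X \<subseteq> Y \<or> X \<subseteq> Z)"

text \<open>
  Normality: \<open>\<O>(X)\<close> is integrally closed in the function field \<open>k(X)\<close>. An element of \<open>k(X)\<close> is a
  quotient \<open>f / g\<close> of regular functions with \<open>g\<close> not identically zero on \<open>X\<close>, and since \<open>X\<close> is
  irreducible an identity holds in \<open>k(X)\<close> iff it holds pointwise on the dense open set where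
  \<open>g \<noteq> 0\<close>. The polynomial functions \<open>c 0, \<dots>, c (d - 1)\<close> represent the lower coefficients of a monic
  polynomial over \<open>\<O>(X)\<close>.
\<close>

definition normal_variety :: "nat \<Rightarrow> (nat \<Rightarrow> 'k::field) set \<Rightarrow> bool" where
  "normal_variety m X \<longleftrightarrow> affine_variety m X \<and>
    (\<forall>f\<in>polynomial_functions m. \<forall>g\<in>polynomial_functions m.
      (\<exists>x\<in>X. g x \<noteq> 0) \<and>
      (\<exists>d c. (\<forall>i<d. c i \<in> polynomial_functions m) \<and>
        (\<forall>x\<in>X. g x \<noteq> 0 \<longrightarrow> (f x / g x) ^ d + (\<Sum>i<d. c i x * (f x / g x) ^ i) = 0))
      \<longrightarrow> (\<exists>h\<in>polynomial_functions m. \<forall>x\<in>X. g x \<noteq> 0 \<longrightarrow> f x / g x = h x))"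

text \<open>
  A map \<open>\<psi> : Y \<rightarrow> k\<^sup>m\<close> is regular with respect to an algebra \<open>A\<close> of functions inducing \<open>\<O>(Y)\<close> if its
  coordinates lie in \<open>\<O>(Y)\<close>.
\<close>

definition regular_map :: "('y \<Rightarrow> 'k) set \<Rightarrow> 'y set \<Rightarrow> nat \<Rightarrow> ('y \<Rightarrow> nat \<Rightarrow> 'k) \<Rightarrow> bool" where
  "regular_map A Y m \<psi> \<longleftrightarrow> (\<forall>j<m. \<exists>p\<in>A. \<forall>y\<in>Y. \<psi> y j = p y)"

definition aut_group :: "nat \<Rightarrow> (nat \<Rightarrow> 'k::field) set \<Rightarrow> ((nat \<Rightarrow> 'k) \<Rightarrow> (nat \<Rightarrow> 'k)) monoid" where
  "aut_group m X = BijGroup X \<lparr>carrier :=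
    {f \<in> Bij X. regular_map (polynomial_functions m) X m f \<and>
                regular_map (polynomial_functions m) X m (inv_into X f)}\<rparr>"


section \<open>Torus actions and actions of the additive group\<close>

definition Gm :: "'k::field monoid" where
  "Gm = \<lparr>carrier = UNIV - {0}, mult = (*), one = 1\<rparr>"

definition Ga :: "'k::field monoid" where
  "Ga = \<lparr>carrier = UNIV, mult = (+), one = 0\<rparr>"

definition torus :: "nat \<Rightarrow> (nat \<Rightarrow> 'k::field) monoid" where
  "torus n = product_group {..<n} (\<lambda>_. Gm)"

text \<open>
  The coordinate algebras of the products \<open>\<T> \<times> X\<close> and \<open>\<bbbG>\<^sub>a \<times> X\<close>: Laurent polynomials in the torus
  coordinates (respectively polynomials in the additive parameter) with coefficients in \<open>\<O>(X)\<close>.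
\<close>

definition torus_product_functions ::
    "nat \<Rightarrow> nat \<Rightarrow> ((nat \<Rightarrow> 'k::field) \<times> (nat \<Rightarrow> 'k) \<Rightarrow> 'k) set" where
  "torus_product_functions n m = function_algebra
    ((\<lambda>i (t, x). t i) ` {..<n} \<union> (\<lambda>i (t, x). inverse (t i)) ` {..<n} \<union> (\<lambda>j (t, x). x j) ` {..<m})"

definition Ga_product_functions :: "nat \<Rightarrow> ('k::field \<times> (nat \<Rightarrow> 'k) \<Rightarrow> 'k) set" where
  "Ga_product_functions m = function_algebra ({\<lambda>(a, x). a} \<union> (\<lambda>j (a, x). x j) ` {..<m})"

text \<open>
  An effective regular action of the torus \<open>(\<bbbG>\<^sub>m)\<^sup>n\<close> with an open orbit. Effectiveness makes the open
  orbit isomorphic to the torus, so \<open>n\<close> is the dimension of \<open>X\<close>.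
\<close>

definition toric_variety ::
    "nat \<Rightarrow> nat \<Rightarrow> (nat \<Rightarrow> 'k::field) set \<Rightarrow> ((nat \<Rightarrow> 'k) \<Rightarrow> (nat \<Rightarrow> 'k) \<Rightarrow> (nat \<Rightarrow> 'k)) \<Rightarrow> bool" where
  "toric_variety n m X \<tau> \<longleftrightarrow> affine_variety m X \<and>
    faithful_action (torus n) X \<tau> \<and>
    regular_map (torus_product_functions n m) (carrier (torus n) \<times> X) m (\<lambda>(t, x). \<tau> t x) \<and>
    (\<exists>x\<in>X. zariski_closed m (X - orbit (torus n) \<tau> x))"

definition Ga_subgroup :: "nat \<Rightarrow> (nat \<Rightarrow> 'k::field) set \<Rightarrow> ((nat \<Rightarrow> 'k) \<Rightarrow> (nat \<Rightarrow> 'k)) set \<Rightarrow> bool" where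
  "Ga_subgroup m X U \<longleftrightarrow> (\<exists>\<phi>. faithful_action Ga X \<phi> \<and>
    regular_map (Ga_product_functions m) (UNIV \<times> X) m (\<lambda>(a, x). \<phi> a x) \<and>
    U = \<phi> ` carrier Ga)"


section \<open>Double transitivity and free groups\<close>

text \<open>
  As usual a transitive action is on a nonempty set; for the set of ordered pairs of distinct elements
  this means that \<open>S\<close> is not a single point.
\<close>

definition doubly_transitive :: "('g, 'r) monoid_scheme \<Rightarrow> ('g \<Rightarrow> 'x \<Rightarrow> 'x) \<Rightarrow> 'x set \<Rightarrow> bool" where
  "doubly_transitive G \<phi> S \<longleftrightarrow>
    (\<exists>a\<in>S. \<exists>b\<in>S. a \<noteq> b) \<and>
    (\<forall>a\<in>S. \<forall>b\<in>S. \<forall>c\<in>S. \<forall>d\<in>S. a \<noteq> b \<and> c \<noteq> d \<longrightarrow>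
      (\<exists>g\<in>carrier G. \<phi> g a = c \<and> \<phi> g b = d))"

text \<open>Words in letters \<open>b\<^sup>\<plusminus>\<^sup>1\<close>: the pair \<open>(b, True)\<close> stands for \<open>b\<close> and \<open>(b, False)\<close> for its inverse.\<close>

definition reduced_word :: "('g \<times> bool) list \<Rightarrow> bool" where
  "reduced_word w \<longleftrightarrow> successively (\<lambda>(a, e) (b, e'). a = b \<longrightarrow> e = e') w"

definition word_value :: "('g, 'r) monoid_scheme \<Rightarrow> ('g \<times> bool) list \<Rightarrow> 'g" where
  "word_value G w = foldr (\<lambda>(b, e) y. (if e then b else inv\<^bsub>G\<^esub> b) \<otimes>\<^bsub>G\<^esub> y) w \<one>\<^bsub>G\<^esub>"

definition free_basis :: "('g, 'r) monoid_scheme \<Rightarrow> 'g set \<Rightarrow> bool" where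
  "free_basis G B \<longleftrightarrow> B \<subseteq> carrier G \<and> generate G B = carrier G \<and>
    (\<forall>w. w \<noteq> [] \<and> fst ` set w \<subseteq> B \<and> reduced_word w \<longrightarrow> word_value G w \<noteq> \<one>\<^bsub>G\<^esub>)"

definition free_group_of_rank :: "('g, 'r) monoid_scheme \<Rightarrow> nat \<Rightarrow> bool" where
  "free_group_of_rank G r \<longleftrightarrow> group G \<and> (\<exists>B. free_basis G B \<and> finite B \<and> card B = r)"

end

theory Submission
  imports Defs
begin

text \<open>
  Fix a point \<open>x0\<close> of the open orbit. The semi-invariants \<open>f\<close> of the torus with \<open>f x0 \<noteq> 0\<close> separate
  the points of \<open>X\<close>, and a normalized \<open>\<bbbG>\<^sub>a\<close>-subgroup acts on them by
  \<open>f (\<phi> a x) = f x \<cdot> (1 + a \<cdot> q x / h x) ^ \<nu> f\<close> with semi-invariants \<open>h\<close>, \<open>q\<close> and an additive \<open>\<nu>\<close>. In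
  the language of Demazure roots, \<open>\<nu>\<close> is the pairing with the distinguished ray \<open>\<rho>\<close> of the root \<open>e\<close>,
  and \<open>q / h\<close> is the character \<open>e\<close>; the pairing \<open>\<langle>\<rho>, e'\<rangle>\<close> with another root is
  \<open>\<nu> q' - \<nu> h'\<close>.

  If two roots have positive pairings in both directions, then a ping-pong argument in the coordinates
  \<open>h / q\<close>, \<open>h' / q'\<close>, normalized to be rational on the group orbit of \<open>x0\<close>, gives a free subgroup. A longer cycle
  of positive pairings is shortened by passing to commutators. Without cycles there is a weight on
  semi-invariants that is lowered by all the root subgroups. Then a semi-invariant \<open>f\<close> of least weight
  among those that are not constant on the \<open>G\<close>-orbit satisfies \<open>f (g x) = f x + c g\<close> there. So \<open>G\<close>
  preserves the differences \<open>f x - f y\<close>, whereas double transitivity allows to swap \<open>x\<close> and \<open>y\<close>.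
\<close>

section \<open>Generic points of a domain of functions\<close>

text \<open>In characteristic zero 2 is not a root of unity, so exponents can be read off from
  powers of 2. This is how levels are recovered from values of semi-invariants.\<close>

lemma two_power_eq_iff: "(2::'a::field_char_0) ^ i = 2 ^ j \<longleftrightarrow> i = j"
proof
  assume "(2::'a) ^ i = 2 ^ j"
  then have "of_nat (2 ^ i) = (of_nat (2 ^ j) :: 'a)"
    by simp
  then have "(2::nat) ^ i = 2 ^ j"
    by (simp only: of_nat_eq_iff)
  then show "i = j"
    by simp
qed simp

text \<open>\<open>P\<close> consists of functions on the whole type, so vanishing is always meant
  on \<open>X\<close>; \<open>prime_P\<close> encodes irreducibility of \<open>X\<close>.\<close>

locale function_domain =
  fixes X :: "'x set" and P :: "('x \<Rightarrow> 'k::field_char_0) set"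
  assumes const_P: "(\<lambda>_. c) \<in> P"
    and add_P: "p \<in> P \<Longrightarrow> q \<in> P \<Longrightarrow> (\<lambda>x. p x + q x) \<in> P"
    and mult_P: "p \<in> P \<Longrightarrow> q \<in> P \<Longrightarrow> (\<lambda>x. p x * q x) \<in> P"
    and prime_P: "p \<in> P \<Longrightarrow> q \<in> P \<Longrightarrow> \<forall>x\<in>X. p x * q x = 0 \<Longrightarrow>
      (\<forall>x\<in>X. p x = 0) \<or> (\<forall>x\<in>X. q x = 0)"
    and nonempty_X: "X \<noteq> {}"
begin

lemma diff_P: "p \<in> P \<Longrightarrow> q \<in> P \<Longrightarrow> (\<lambda>x. p x - q x) \<in> P"
  using add_P[OF _ mult_P[OF const_P[of "-1"]], of p q] by simp

lemma power_P: "p \<in> P \<Longrightarrow> (\<lambda>x. p x ^ n) \<in> P"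
  by (induction n) (auto intro: const_P mult_P)

lemma sum_P: "(\<And>i. i \<in> I \<Longrightarrow> p i \<in> P) \<Longrightarrow> (\<lambda>x. \<Sum>i\<in>I. p i x) \<in> P"
  by (induction I rule: infinite_finite_induct) (auto intro: const_P add_P)

text \<open>The filter generated by the nonempty principal open sets. Irreducibility makes it
  proper, and eventual equality replaces equality in the function field, with divisions done
  pointwise.\<close>

definition generic :: "'x filter" where
  "generic = (INF p\<in>{p \<in> P. \<exists>x\<in>X. p x \<noteq> 0}. principal {x \<in> X. p x \<noteq> 0})"

lemma eventually_generic:
  "eventually A generic \<longleftrightarrow> (\<exists>p\<in>P. (\<exists>x\<in>X. p x \<noteq> 0) \<and> (\<forall>x\<in>X. p x \<noteq> 0 \<longrightarrow> A x))"
proof -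
  let ?B = "{p \<in> P. \<exists>x\<in>X. p x \<noteq> 0}"
  have "?B \<noteq> {}"
    using const_P[of 1] nonempty_X by force
  moreover have "\<exists>r\<in>?B. principal {x \<in> X. r x \<noteq> 0}
      \<le> inf (principal {x \<in> X. p x \<noteq> 0}) (principal {x \<in> X. q x \<noteq> 0})"
    if "p \<in> ?B" "q \<in> ?B" for p q
    using that prime_P[of p q] mult_P[of p q]
    by (intro bexI[of _ "\<lambda>x. p x * q x"]) auto
  ultimately have "eventually A generic \<longleftrightarrow> (\<exists>p\<in>?B. eventually A (principal {x \<in> X. p x \<noteq> 0}))"
    unfolding generic_def by (rule eventually_INF_base)
  then show ?thesis
    by (auto simp: eventually_principal)
qed

lemma generic_in: "\<forall>\<^sub>F x in generic. x \<in> X"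
  unfolding eventually_generic using const_P[of 1] nonempty_X by (intro bexI[of _ "\<lambda>_. 1"]) auto

lemma generic_nonzero: "p \<in> P \<Longrightarrow> x \<in> X \<Longrightarrow> p x \<noteq> 0 \<Longrightarrow> \<forall>\<^sub>F x in generic. p x \<noteq> 0"
  unfolding eventually_generic by auto

lemma generic_ex: "eventually A generic \<Longrightarrow> \<exists>x\<in>X. A x"
  unfolding eventually_generic by auto

lemma generic_zero:
  assumes "p \<in> P" "\<forall>\<^sub>F x in generic. p x = 0" "x \<in> X"
  shows "p x = 0"
proof (rule ccontr)
  assume "p x \<noteq> 0"
  from generic_nonzero[OF assms(1,3) this] assms(2) have "\<forall>\<^sub>F x in generic. False"
    by eventually_elim simp
  then show False
    using generic_ex by blast
qed

lemma generic_eq: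
  assumes "p \<in> P" "q \<in> P" "\<forall>\<^sub>F x in generic. p x = q x" "x \<in> X"
  shows "p x = q x"
  using generic_zero[OF diff_P[OF assms(1,2)] _ assms(4)] assms(3) by simp

end

section \<open>Roots and their action on semi-invariants\<close>

datatype ('x, 'k) root =
  Root (grp: "'k \<Rightarrow> 'x \<Rightarrow> 'x") (level: "('x \<Rightarrow> 'k) \<Rightarrow> nat") (den: "'x \<Rightarrow> 'k") (num: "'x \<Rightarrow> 'k")

definition slope :: "('x, 'k::field) root \<Rightarrow> 'x \<Rightarrow> 'k" where
  "slope r x = num r x / den r x"

definition pairing :: "('x, 'k) root \<Rightarrow> ('x, 'k) root \<Rightarrow> int" where
  "pairing r r' = int (level r (num r')) - int (level r (den r'))"

text \<open>The torus is left behind here. What remains of it is a monoid \<open>D\<close> of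
  regular functions that do not vanish at \<open>x0\<close> and separate the points of
  \<open>X\<close>; \<open>K\<close> is a group of regular bijections.\<close>

locale semi_invariants = function_domain X P
  for X :: "'x set" and P :: "('x \<Rightarrow> 'k::field_char_0) set" +
  fixes K :: "('x \<Rightarrow> 'x) set" and D :: "('x \<Rightarrow> 'k) set" and x0 :: 'x
  assumes subgroup_K: "subgroup K (BijGroup X)"
    and regular_K: "g \<in> K \<Longrightarrow> p \<in> P \<Longrightarrow> \<exists>p'\<in>P. \<forall>x\<in>X. p (g x) = p' x"
    and D_subset: "D \<subseteq> P"
    and one_D: "(\<lambda>_. 1) \<in> D"
    and mult_D: "f \<in> D \<Longrightarrow> f' \<in> D \<Longrightarrow> (\<lambda>x. f x * f' x) \<in> D"
    and x0: "x0 \<in> X"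
    and D_nonzero: "f \<in> D \<Longrightarrow> f x0 \<noteq> 0"
    and D_separates: "x \<in> X \<Longrightarrow> y \<in> X \<Longrightarrow> (\<And>f. f \<in> D \<Longrightarrow> f x = f y) \<Longrightarrow> x = y"
begin

lemma D_P: "f \<in> D \<Longrightarrow> f \<in> P"
  using D_subset by auto

lemma power_D: "f \<in> D \<Longrightarrow> (\<lambda>x. f x ^ n) \<in> D"
  by (induction n) (auto intro: one_D mult_D)

lemma D_generic: "f \<in> D \<Longrightarrow> \<forall>\<^sub>F x in generic. f x \<noteq> 0"
  using generic_nonzero D_P x0 D_nonzero by blast

lemma K_Bij: "g \<in> K \<Longrightarrow> g \<in> Bij X"
  using subgroup.subset[OF subgroup_K] by (auto simp: BijGroup_def)

lemma K_bij: "g \<in> K \<Longrightarrow> bij_betw g X X"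
  using K_Bij by (auto simp: Bij_def)

lemma K_in: "g \<in> K \<Longrightarrow> x \<in> X \<Longrightarrow> g x \<in> X"
  using K_bij bij_betwE by blast

lemma K_compose: "g \<in> K \<Longrightarrow> g' \<in> K \<Longrightarrow> compose X g g' \<in> K"
  using subgroup.m_closed[OF subgroup_K, of g g'] K_Bij by (auto simp: BijGroup_def)

lemma K_inv: "g \<in> K \<Longrightarrow> restrict (inv_into X g) X \<in> K"
  using subgroup.m_inv_closed[OF subgroup_K, of g] K_Bij by (auto simp: inv_BijGroup restrict_def)

lemma K_inv_right: "g \<in> K \<Longrightarrow> x \<in> X \<Longrightarrow> g (restrict (inv_into X g) X x) = x"
  using K_bij by (auto simp: bij_betw_def f_inv_into_f)

text \<open>Pulling back along \<open>g\<close> turns a principal open set into a principal open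
  set; it stays nonempty because \<open>g\<close> is surjective.\<close>

lemma generic_translate:
  assumes "g \<in> K" "eventually A generic"
  shows "\<forall>\<^sub>F x in generic. A (g x)"
proof -
  from assms(2) obtain p y where p: "p \<in> P" "y \<in> X" "p y \<noteq> 0" "\<forall>x\<in>X. p x \<noteq> 0 \<longrightarrow> A x"
    unfolding eventually_generic by auto
  from regular_K[OF assms(1) p(1)] obtain p' where p': "p' \<in> P" "\<forall>x\<in>X. p (g x) = p' x"
    by auto
  let ?z = "restrict (inv_into X g) X y"
  have "?z \<in> X"
    using K_in[OF K_inv[OF assms(1)] p(2)] .
  with p' have "p' ?z \<noteq> 0"
    using K_inv_right[OF assms(1) p(2)] p(3) by fastforce
  then show ?thesis
    unfolding eventually_generic
    using p' p(4) \<open>?z \<in> X\<close> K_in[OF assms(1)] by (intro bexI[of _ p']) auto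
qed

text \<open>\<open>F\<close> need not be a multiple of a slope: conjugates of root elements act with
  a factor \<open>1 + F\<close> for a more complicated rational function \<open>F\<close>.\<close>

definition acts :: "(('x \<Rightarrow> 'k) \<Rightarrow> nat) \<Rightarrow> ('x \<Rightarrow> 'k) \<Rightarrow> ('x \<Rightarrow> 'x) \<Rightarrow> bool" where
  "acts \<nu> F g \<longleftrightarrow> (\<forall>f\<in>D. \<forall>\<^sub>F x in generic. f (g x) = f x * (1 + F x) ^ \<nu> f)"

lemma actsD: "acts \<nu> F g \<Longrightarrow> f \<in> D \<Longrightarrow> \<forall>\<^sub>F x in generic. f (g x) = f x * (1 + F x) ^ \<nu> f"
  by (auto simp: acts_def)

text \<open>Where \<open>1 + F x\<close> vanishes, \<open>f (g x)\<close> would vanish too, but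
  \<open>f\<close> composed with \<open>g\<close> is generically nonzero.\<close>

lemma acts_nonzero:
  assumes "g \<in> K" "acts \<nu> F g" "f \<in> D" "\<nu> f > 0"
  shows "\<forall>\<^sub>F x in generic. 1 + F x \<noteq> 0"
  using actsD[OF assms(2,3)] generic_translate[OF assms(1) D_generic[OF assms(3)]]
  by eventually_elim (use assms(4) in auto)

text \<open>The condition on \<open>den\<close> and \<open>num\<close> says that the root pairs to
  -1 with its own ray. The last clause says that \<open>f\<close> times the \<open>k\<close>-th
  power of the slope is again in \<open>D\<close> as long as the level permits: the weight of
  \<open>f\<close> plus \<open>k\<close> times the root stays in the cone of weights.\<close>

definition is_root :: "('x, 'k) root \<Rightarrow> bool" where
  "is_root r \<longleftrightarrow> den r \<in> D \<and> num r \<in> D \<and> level r (den r) = level r (num r) + 1 \<and>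
    (\<forall>a. grp r a \<in> K \<and> acts (level r) (\<lambda>x. a * slope r x) (grp r a)) \<and>
    (\<forall>f\<in>D. \<forall>k\<le>level r f. \<exists>f'\<in>D. \<forall>x\<in>X. f' x * den r x ^ k = f x * num r x ^ k)"

lemma
  assumes "is_root r"
  shows den_D: "den r \<in> D" and num_D: "num r \<in> D"
    and level_den: "level r (den r) = level r (num r) + 1"
    and grp_K: "grp r a \<in> K"
    and grp_acts: "acts (level r) (\<lambda>x. a * slope r x) (grp r a)"
  using assms by (auto simp: is_root_def)

lemma root_shift:
  assumes "is_root r" "f \<in> D" "k \<le> level r f"
  obtains f' where "f' \<in> D" "\<And>x. x \<in> X \<Longrightarrow> f' x * den r x ^ k = f x * num r x ^ k"
  using assms unfolding is_root_def by blast

text \<open>Cleared of denominators, the identity is between regular functions, so it passes from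
  generic points to every point of \<open>X\<close>.\<close>

lemma acts_pointwise:
  assumes "g \<in> K" "is_root r" "acts (level r) (\<lambda>x. a * slope r x) g" "f \<in> D" "x \<in> X"
  shows "f (g x) * den r x ^ level r f = f x * (den r x + a * num r x) ^ level r f"
proof -
  obtain p where p: "p \<in> P" "\<And>x. x \<in> X \<Longrightarrow> f (g x) = p x"
    using regular_K[OF assms(1) D_P[OF assms(4)]] by auto
  note D = D_P[OF assms(4)] D_P[OF den_D[OF assms(2)]] D_P[OF num_D[OF assms(2)]]
  have "p x * den r x ^ level r f = f x * (den r x + a * num r x) ^ level r f"
  proof (rule generic_eq[OF _ _ _ assms(5)])
    show "\<forall>\<^sub>F x in generic. p x * den r x ^ level r f = f x * (den r x + a * num r x) ^ level r f"
      using actsD[OF assms(3,4)] D_generic[OF den_D[OF assms(2)]] generic_in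
    proof eventually_elim
      case (elim x)
      then have "1 + a * slope r x = (den r x + a * num r x) / den r x"
        by (simp add: slope_def field_simps)
      with elim show ?case
        by (simp add: p(2)[symmetric] power_divide)
    qed
    show "(\<lambda>x. p x * den r x ^ level r f) \<in> P"
      by (intro mult_P power_P p D)
    show "(\<lambda>x. f x * (den r x + a * num r x) ^ level r f) \<in> P"
      by (intro mult_P power_P add_P const_P D)
  qed
  with p(2)[OF assms(5)] show ?thesis
    by simp
qed

lemma acts_at:
  assumes "g \<in> K" "is_root r" "acts (level r) (\<lambda>x. a * slope r x) g" "f \<in> D" "x \<in> X"
    and "den r x \<noteq> 0"
  shows "f (g x) = f x * (1 + a * slope r x) ^ level r f"
proof -
  have "1 + a * slope r x = (den r x + a * num r x) / den r x"
    using assms(6) by (simp add: slope_def field_simps)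
  moreover have "f (g x) = f x * (den r x + a * num r x) ^ level r f / den r x ^ level r f"
    using acts_pointwise[OF assms(1-5)] assms(6) by (simp add: eq_divide_eq)
  ultimately show ?thesis
    by (simp add: power_divide)
qed

text \<open>Multiplicativity of the values at a translate of \<open>x0\<close> forces additivity of
  the exponents. The product formula is required on \<open>X\<close> only, because members of
  \<open>D\<close> can differ off \<open>X\<close>.\<close>

lemma level_cong:
  assumes "is_root r" "f \<in> D" "f' \<in> D" "f'' \<in> D"
    and "\<And>x. x \<in> X \<Longrightarrow> f x = f' x * f'' x"
  shows "level r f = level r f' + level r f''"
proof -
  \<comment> \<open>This parameter makes the factor \<open>1 + a * slope r x0\<close> equal to 2, so
    the level becomes visible as an exponent of 2.\<close>
  define a where "a = 1 / slope r x0"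
  have nz: "den r x0 \<noteq> 0" "num r x0 \<noteq> 0"
    using D_nonzero den_D num_D assms(1) by auto
  then have "slope r x0 \<noteq> 0"
    by (simp add: slope_def)
  then have two: "1 + a * slope r x0 = 2"
    by (simp add: a_def)
  have at: "h (grp r a x0) = h x0 * 2 ^ level r h" if "h \<in> D" for h
    using acts_at[OF grp_K[OF assms(1)] assms(1) grp_acts[OF assms(1)] that x0 nz(1), of a] two by simp
  have "f (grp r a x0) = f' (grp r a x0) * f'' (grp r a x0)"
    using assms(5) K_in[OF grp_K[OF assms(1)] x0] by blast
  then have "f x0 * 2 ^ level r f = f' x0 * f'' x0 * 2 ^ (level r f' + level r f'')"
    using at[OF assms(2)] at[OF assms(3)] at[OF assms(4)] by (simp add: power_add mult_ac)
  with assms(5)[OF x0] D_nonzero[OF assms(2)]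
  have "(2::'k) ^ level r f = 2 ^ (level r f' + level r f'')"
    by simp
  then show ?thesis
    by (simp only: two_power_eq_iff)
qed

lemma level_mult:
  "is_root r \<Longrightarrow> f \<in> D \<Longrightarrow> f' \<in> D \<Longrightarrow> level r (\<lambda>x. f x * f' x) = level r f + level r f'"
  by (rule level_cong) (auto intro: mult_D)

lemma level_one: "is_root r \<Longrightarrow> level r (\<lambda>_. 1) = 0"
  using level_cong[of r "\<lambda>_. 1" "\<lambda>_. 1" "\<lambda>_. 1"] one_D by simp

lemma level_power: "is_root r \<Longrightarrow> f \<in> D \<Longrightarrow> level r (\<lambda>x. f x ^ n) = n * level r f"
  by (induction n) (auto simp: level_one level_mult power_D)

section \<open>Pairings between roots\<close>

text \<open>Apply additivity of \<open>level r\<close> to the relation that defines the shift. In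
  weights, adding \<open>k\<close> times the root of \<open>r'\<close> changes the pairing with the
  ray of \<open>r\<close> by \<open>k * pairing r r'\<close>.\<close>

lemma level_shift:
  assumes "is_root r" "is_root r'" "f \<in> D" "f' \<in> D"
    and "\<And>x. x \<in> X \<Longrightarrow> f' x * den r' x ^ k = f x * num r' x ^ k"
  shows "int (level r f') = int (level r f) + int k * pairing r r'"
proof -
  note D = den_D[OF assms(2)] num_D[OF assms(2)]
  have "level r (\<lambda>x. f' x * den r' x ^ k) = level r f + level r (\<lambda>x. num r' x ^ k)"
    by (rule level_cong) (use assms D in \<open>auto intro!: mult_D power_D\<close>)
  then have "level r f' + k * level r (den r') = level r f + k * level r (num r')"
    using assms D by (simp add: level_mult level_power power_D)
  then have "int (level r f') + int k * int (level r (den r')) = int (level r f) + int k * int (level r (num r'))"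
    by (metis of_nat_add of_nat_mult)
  then show ?thesis
    by (simp add: pairing_def algebra_simps)
qed

lemma pairing_self: "is_root r \<Longrightarrow> level r = level r' \<Longrightarrow> is_root r' \<Longrightarrow> pairing r r' = -1"
  by (simp add: pairing_def level_den)

text \<open>Shift \<open>f\<close> along \<open>r'\<close> as far as possible. Each of the
  \<open>level r' f\<close> steps lowers \<open>level r\<close> by at least one, and levels are
  natural numbers.\<close>

lemma pairing_level_le:
  assumes "is_root r" "is_root r'" "pairing r r' < 0" "f \<in> D"
  shows "level r f \<ge> level r' f"
proof -
  obtain f' where f': "f' \<in> D"
    "\<And>x. x \<in> X \<Longrightarrow> f' x * den r' x ^ level r' f = f x * num r' x ^ level r' f"
    using root_shift[OF assms(2,4) order_refl] by blast
  have "int (level r f') = int (level r f) + int (level r' f) * pairing r r'"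
    by (rule level_shift) (use assms f' in auto)
  moreover have "int (level r' f) * pairing r r' \<le> int (level r' f) * (-1)"
    using assms(3) by (intro mult_left_mono) auto
  ultimately show ?thesis
    by linarith
qed

text \<open>In terms of the fan: two Demazure roots with negative pairing belong to the same ray.\<close>

lemma pairing_neg_imp_level_eq:
  assumes "is_root r" "is_root r'" "pairing r r' < 0" "f \<in> D"
  shows "level r f = level r' f"
proof -
  \<comment> \<open>Once this pairing is negative too, \<open>pairing_level_le\<close> gives both
    inequalities.\<close>
  have "pairing r' r < 0"
  proof (rule ccontr)
    assume neg: "\<not> pairing r' r < 0"
    \<comment> \<open>Shifting \<open>den r'\<close> along \<open>r\<close> by its full level brings
      \<open>level r\<close> down to 0 while \<open>level r'\<close> stays positive, against
      \<open>pairing_level_le\<close>.\<close>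
    let ?k = "level r (den r')"
    obtain f' where f': "f' \<in> D" "\<And>x. x \<in> X \<Longrightarrow> f' x * den r x ^ ?k = den r' x * num r x ^ ?k"
      using root_shift[OF assms(1) den_D[OF assms(2)] order_refl] by blast
    have "int (level r f') = int ?k + int ?k * pairing r r"
      "int (level r' f') = int (level r' (den r')) + int ?k * pairing r' r"
      by (rule level_shift; use assms f' den_D in auto)+
    moreover have "0 \<le> int ?k * pairing r' r"
      using neg by simp
    ultimately have "level r f' = 0" "level r' f' > 0"
      using pairing_self[of r r] assms(1) level_den[OF assms(2)] by auto
    then show False
      using pairing_level_le[OF assms(1-3) f'(1)] by simp
  qed
  then show ?thesis
    using pairing_level_le assms by (meson order_antisym)
qed

section \<open>Composition of root elements\<close>

lemma acts_slope:
  assumes "g \<in> K" "acts (level r) F g" "is_root r'" "pairing r r' = int n"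
  shows "\<forall>\<^sub>F x in generic. slope r' (g x) = slope r' x * (1 + F x) ^ n"
  using actsD[OF assms(2) den_D[OF assms(3)]] actsD[OF assms(2) num_D[OF assms(3)]]
    generic_translate[OF assms(1) D_generic[OF den_D[OF assms(3)]]]
proof eventually_elim
  case (elim x)
  have "level r (num r') = level r (den r') + n"
    using assms(4) by (simp add: pairing_def)
  with elim show ?case
    by (auto simp: slope_def power_add)
qed

text \<open>The pairing of a root with itself is -1, so one factor \<open>1 + F\<close> is left over
  in the denominator.\<close>

lemma acts_slope_self:
  assumes "g \<in> K" "is_root r" "acts (level r) F g"
  shows "\<forall>\<^sub>F x in generic. slope r (g x) = slope r x / (1 + F x)"
  using actsD[OF assms(3) den_D[OF assms(2)]] actsD[OF assms(3) num_D[OF assms(2)]]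
    generic_translate[OF assms(1) D_generic[OF den_D[OF assms(2)]]]
  by eventually_elim (use level_den[OF assms(2)] in \<open>simp add: slope_def\<close>)

text \<open>The factor of the composite is
  \<open>(1 + F') * (1 + F / (1 + F')) = 1 + (F + F')\<close>. The last hypothesis is how a slope
  behaves under its own root group.\<close>

lemma acts_compose:
  assumes "g' \<in> K" "acts \<nu> F g" "acts \<nu> F' g'"
    and "\<forall>\<^sub>F x in generic. 1 + F' x \<noteq> 0" "\<forall>\<^sub>F x in generic. F (g' x) = F x / (1 + F' x)"
  shows "acts \<nu> (\<lambda>x. F x + F' x) (compose X g g')"
  unfolding acts_def
proof
  fix f assume f: "f \<in> D"
  show "\<forall>\<^sub>F x in generic. f (compose X g g' x) = f x * (1 + (F x + F' x)) ^ \<nu> f"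
    using generic_translate[OF assms(1) actsD[OF assms(2) f]] actsD[OF assms(3) f] assms(4,5) generic_in
  proof eventually_elim
    case (elim x)
    have "f (compose X g g' x) = f x * ((1 + F' x) * (1 + F x / (1 + F' x))) ^ \<nu> f"
      using elim by (simp add: compose_eq power_mult_distrib)
    also have "(1 + F' x) * (1 + F x / (1 + F' x)) = 1 + (F x + F' x)"
      using elim by (simp add: field_simps)
    finally show ?case .
  qed
qed

lemma acts_inverse:
  assumes "g \<in> K" "is_root r" "acts (level r) (\<lambda>x. a * slope r x) g"
  shows "acts (level r) (\<lambda>x. - a * slope r x) (restrict (inv_into X g) X)"
  unfolding acts_def
proof
  fix f assume f: "f \<in> D"
  let ?h = "restrict (inv_into X g) X"
  note tr = generic_translate[OF K_inv[OF assms(1)]]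
  have "level r (den r) > 0"
    using level_den[OF assms(2)] by simp
  note nz = acts_nonzero[OF assms(1,3) den_D[OF assms(2)] this]
  show "\<forall>\<^sub>F x in generic. f (?h x) = f x * (1 + - a * slope r x) ^ level r f"
    using tr[OF actsD[OF assms(3) f]] tr[OF nz] tr[OF acts_slope_self[OF assms]] generic_in
  proof eventually_elim
    case (elim x)
    have gh: "g (?h x) = x"
      using K_inv_right[OF assms(1) elim(4)] .
    \<comment> \<open>If \<open>?u\<close> is the factor of \<open>g\<close> at the preimage of
      \<open>x\<close>, then the slope at \<open>x\<close> is the slope there divided by
      \<open>?u\<close>, and \<open>1 - a * slope r x\<close> becomes \<open>1 / ?u\<close>.\<close>
    let ?u = "1 + a * slope r (?h x)"
    have "slope r x = slope r (?h x) / ?u" "f x = f (?h x) * ?u ^ level r f" "?u \<noteq> 0"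
      using elim(1-3) by (simp_all only: gh not_False_eq_True)
    moreover from this have "1 + - a * slope r x = 1 / ?u"
      by (simp add: field_simps)
    ultimately show ?case
      by (simp add: power_divide)
  qed
qed

text \<open>Replacing \<open>s\<close> by \<open>2 * s\<close> and subtracting
  \<open>2 ^ Suc n\<close> times the original eliminates the top coefficient and rescales the others
  by nonzero factors. So the induction recovers these, and the top one follows by subtraction at
  \<open>s = 1\<close>.\<close>

lemma coefficients_in_subspace:
  fixes V :: "'k poly set"
  assumes "\<And>p q. p \<in> V \<Longrightarrow> q \<in> V \<Longrightarrow> p + q \<in> V" "\<And>c p. p \<in> V \<Longrightarrow> smult c p \<in> V"
    and "\<And>s. (\<Sum>k\<le>n. smult (s ^ k) (v k)) \<in> V" "k \<le> n"
  shows "v k \<in> V"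
  using assms(3,4)
proof (induction n arbitrary: v k)
  case 0
  then show ?case
    using "0.prems"(1)[of 1] by simp
next
  case (Suc n)
  have diff: "p - q \<in> V" if "p \<in> V" "q \<in> V" for p q
    using assms(1)[OF that(1) assms(2)[OF that(2), of "-1"]] by simp
  have lower: "v j \<in> V" if "j \<le> n" for j
  proof -
    let ?c = "\<lambda>k. 2 ^ k - 2 ^ Suc n :: 'k"
    have "(\<Sum>k\<le>n. smult (s ^ k) (smult (?c k) (v k))) \<in> V" for s
    proof -
      have "(\<Sum>k\<le>Suc n. smult ((2 * s) ^ k) (v k)) - smult (2 ^ Suc n) (\<Sum>k\<le>Suc n. smult (s ^ k) (v k)) \<in> V"
        by (intro diff assms(2) Suc.prems(1))
      also have "(\<Sum>k\<le>Suc n. smult ((2 * s) ^ k) (v k)) - smult (2 ^ Suc n) (\<Sum>k\<le>Suc n. smult (s ^ k) (v k))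
          = (\<Sum>k\<le>Suc n. smult (s ^ k) (smult (?c k) (v k)))"
        by (rule poly_eqI)
          (simp add: coeff_sum sum_distrib_left sum_subtractf[symmetric] algebra_simps power_mult_distrib
            del: sum.atMost_Suc power_Suc)
      also have "\<dots> = (\<Sum>k\<le>n. smult (s ^ k) (smult (?c k) (v k)))"
        by (subst sum.atMost_Suc) simp
      finally show ?thesis .
    qed
    then have "smult (?c j) (v j) \<in> V"
      using Suc.IH[of "\<lambda>k. smult (?c k) (v k)" j] that by blast
    moreover have "?c j \<noteq> 0"
      using that two_power_eq_iff[of j "Suc n", where ?'a = 'k] by simp
    ultimately show ?thesis
      using assms(2)[of "smult (?c j) (v j)" "inverse (?c j)"] by simp
  qed
  have "0 \<in> V"
    using diff[OF Suc.prems(1) Suc.prems(1)] by (metis diff_self)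
  then have "sum v A \<in> V" if "A \<subseteq> {..n}" for A
    using that lower by (induction A rule: infinite_finite_induct) (auto intro: assms(1))
  from diff[OF Suc.prems(1)[of 1] this[of "{..n}"]] have "v (Suc n) \<in> V"
    by simp
  with lower Suc.prems(2) show ?case
    by (cases "k = Suc n") auto
qed

section \<open>Commutators of roots\<close>

text \<open>With \<open>u = 1 + s * slope r1\<close>, the first map multiplies
  \<open>slope r2\<close> by \<open>u ^ n\<close> and \<open>f\<close> by a power of
  \<open>u\<close>. The second leaves \<open>slope r1\<close> alone since
  \<open>pairing r2 r1 = 0\<close>, so the last map cancels exactly that power.\<close>

lemma conjugate_acts:
  assumes "is_root r1" "is_root r2" "pairing r1 r2 = int n" "pairing r2 r1 = 0"
  obtains g where "g \<in> K" "acts (level r2) (\<lambda>x. t * slope r2 x * (1 + s * slope r1 x) ^ n) g"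
proof
  let ?g1 = "grp r1 s" and ?g2 = "grp r2 t" and ?g3 = "grp r1 (- s)"
  let ?g = "compose X ?g3 (compose X ?g2 ?g1)"
  note K = grp_K[OF assms(1)] grp_K[OF assms(2)]
  note acts1 = grp_acts[OF assms(1)] and acts2 = grp_acts[OF assms(2)]
  show "?g \<in> K"
    by (intro K_compose K)
  have nz: "\<forall>\<^sub>F x in generic. 1 + s * slope r1 x \<noteq> 0"
    using acts_nonzero[OF K(1) acts1 den_D[OF assms(1)]] level_den[OF assms(1)] by simp
  have slope2: "\<forall>\<^sub>F x in generic. slope r1 (?g2 x) = slope r1 x"
    using acts_slope[OF K(2) acts2 assms(1), of 0 t] assms(4) by simp
  show "acts (level r2) (\<lambda>x. t * slope r2 x * (1 + s * slope r1 x) ^ n) ?g"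
    unfolding acts_def
  proof
    fix f assume f: "f \<in> D"
    note tr1 = generic_translate[OF K(1)] and tr2 = generic_translate[OF K(2)]
    show "\<forall>\<^sub>F x in generic. f (?g x) = f x * (1 + t * slope r2 x * (1 + s * slope r1 x) ^ n) ^ level r2 f"
      using actsD[OF acts1[of s] f] tr1[OF actsD[OF acts2[of t] f], of s]
        tr1[OF tr2[OF actsD[OF acts1[of "- s"] f], of t], of s]
        acts_slope_self[OF K(1) assms(1) acts1, of s] tr1[OF slope2, of s]
        acts_slope[OF K(1) acts1 assms(2,3), of s] nz generic_in
    proof eventually_elim
      case (elim x)
      let ?u = "1 + s * slope r1 x"
      have inX: "?g1 x \<in> X" "?g2 (?g1 x) \<in> X"
        using K_in K elim(8) by blast+
      have u: "1 + - s * (slope r1 x / ?u) = 1 / ?u"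
        using elim(7) by (simp add: field_simps)
      have "f (?g x) = f (?g3 (?g2 (?g1 x)))"
        using elim(8) inX by (simp add: compose_eq)
      also have "\<dots> = f x * ?u ^ level r1 f * (1 + t * (slope r2 x * ?u ^ n)) ^ level r2 f * (1 / ?u) ^ level r1 f"
        by (simp only: elim(1-6) u)
      also have "\<dots> = f x * (1 + t * slope r2 x * ?u ^ n) ^ level r2 f"
        using elim(7) by (simp add: power_divide mult.assoc)
      finally show ?case .
    qed
  qed
qed

text \<open>The conjugates of the second root group by the first one move
  along the slopes \<open>slope r2 \<cdot> (1 + s \<cdot> slope r1)\<^sup>n\<close>, and these moves compose additively; hence the
  coefficient of \<open>s\<close> is again realised in \<open>K\<close>.\<close>

lemma commutator_root:
  assumes "is_root r1" "is_root r2" "pairing r1 r2 > 0" "pairing r2 r1 = 0"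
  obtains r where "is_root r" "level r = level r2"
    "\<And>r'. is_root r' \<Longrightarrow> pairing r' r = pairing r' r1 + pairing r' r2"
proof -
  obtain n where n: "pairing r1 r2 = int n" "n > 0"
    using assms(3) by (metis zero_less_imp_eq_int)
  define F where "F t p x = t * slope r2 x * poly p (slope r1 x)" for t p x
  \<comment> \<open>\<open>V\<close> collects the polynomials \<open>p\<close> for which all moves
    along \<open>slope r2\<close> times \<open>p\<close> at \<open>slope r1\<close> come from
    \<open>K\<close>. It is a linear subspace: sums come from composition, scalars are absorbed in
    \<open>t\<close>.\<close>
  define V where "V = {p. \<forall>t. \<exists>g\<in>K. acts (level r2) (F t p) g}"
  have V_add: "p + q \<in> V" if pq: "p \<in> V" "q \<in> V" for p q
    unfolding V_def mem_Collect_eq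
  proof
    fix t
    obtain g g' where g: "g \<in> K" "acts (level r2) (F t p) g" and g': "g' \<in> K" "acts (level r2) (F t q) g'"
      using pq unfolding V_def by blast
    have nz: "\<forall>\<^sub>F x in generic. 1 + F t q x \<noteq> 0"
      using acts_nonzero[OF g' den_D[OF assms(2)]] level_den[OF assms(2)] by simp
    have slope1: "\<forall>\<^sub>F x in generic. slope r1 (g' x) = slope r1 x"
      using acts_slope[OF g' assms(1), of 0] by (simp add: assms(4))
    have "\<forall>\<^sub>F x in generic. F t p (g' x) = F t p x / (1 + F t q x)"
      using acts_slope_self[OF g'(1) assms(2) g'(2)] slope1
      by eventually_elim (simp add: F_def)
    from acts_compose[OF g'(1) g(2) g'(2) nz this]
    have "acts (level r2) (F t (p + q)) (compose X g g')"
      by (simp add: F_def[abs_def] algebra_simps)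
    then show "\<exists>g\<in>K. acts (level r2) (F t (p + q)) g"
      using K_compose g(1) g'(1) by blast
  qed
  have V_smult: "smult c p \<in> V" if "p \<in> V" for c p
  proof -
    have "F t (smult c p) = F (t * c) p" for t
      by (simp add: F_def fun_eq_iff mult_ac)
    with that show ?thesis
      by (simp add: V_def)
  qed
  have V_conj: "(\<Sum>k\<le>n. smult (s ^ k) (monom (of_nat (n choose k)) k)) \<in> V" (is "?p \<in> V") for s
  proof -
    have "poly ?p z = (1 + s * z) ^ n" for z
      using binomial_ring[of "s * z" 1 n] by (simp add: poly_sum poly_monom power_mult_distrib mult_ac add.commute)
    then have "F t ?p = (\<lambda>x. t * slope r2 x * (1 + s * slope r1 x) ^ n)" for t
      by (simp add: F_def fun_eq_iff)
    moreover have "\<exists>g\<in>K. acts (level r2) (\<lambda>x. t * slope r2 x * (1 + s * slope r1 x) ^ n) g" for t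
      by (rule conjugate_acts[OF assms(1,2) n(1) assms(4)]) blast
    ultimately show ?thesis
      by (simp add: V_def)
  qed
  \<comment> \<open>The coefficient of \<open>s\<close> in \<open>(1 + s * z) ^ n\<close> is
    \<open>n * z\<close>, and the positive integer \<open>n\<close> can be divided out.\<close>
  have "monom (of_nat (n choose 1)) 1 \<in> V"
    by (rule coefficients_in_subspace[OF V_add V_smult V_conj]) (use n(2) in auto)
  from V_smult[OF this, of "inverse (of_nat n)"] have V1: "monom 1 1 \<in> V"
    using n(2) by (simp add: smult_monom)
  then have "\<forall>t. \<exists>g. g \<in> K \<and> acts (level r2) (F t (monom 1 1)) g"
    unfolding V_def by blast
  then obtain psi where psi: "\<And>t. psi t \<in> K \<and> acts (level r2) (F t (monom 1 1)) (psi t)"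
    by metis
  \<comment> \<open>The slope is the product of the two slopes, so the new root is the sum of the
    roots, while its ray is that of \<open>r2\<close>.\<close>
  define r where "r = Root psi (level r2) (\<lambda>x. den r1 x * den r2 x) (\<lambda>x. num r1 x * num r2 x)"
  note D = den_D[OF assms(1)] den_D[OF assms(2)] num_D[OF assms(1)] num_D[OF assms(2)]
  have "F t (monom 1 1) = (\<lambda>x. t * slope r x)" for t
    by (simp add: F_def r_def slope_def poly_monom fun_eq_iff mult_ac)
  with psi have "\<forall>t. grp r t \<in> K \<and> acts (level r) (\<lambda>x. t * slope r x) (grp r t)"
    by (simp add: r_def)
  moreover have "level r (den r) = level r (num r) + 1"
    using assms(4) D level_den[OF assms(2)] by (simp add: r_def level_mult assms(2) pairing_def)
  moreover have "\<exists>f'\<in>D. \<forall>x\<in>X. f' x * den r x ^ k = f x * num r x ^ k" if f: "f \<in> D" "k \<le> level r f" for f k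
  proof -
    \<comment> \<open>The shift is done in two stages. Shifting along \<open>r2\<close> raises
      \<open>level r1\<close> by \<open>k * n\<close>, which makes room for \<open>k\<close> steps
      along \<open>r1\<close>.\<close>
    obtain f1 where f1: "f1 \<in> D" "\<And>x. x \<in> X \<Longrightarrow> f1 x * den r2 x ^ k = f x * num r2 x ^ k"
      using root_shift[OF assms(2) f(1), of k] f(2) by (auto simp: r_def)
    have "int (level r1 f1) = int (level r1 f) + int k * pairing r1 r2"
      by (rule level_shift) (use assms f f1 in auto)
    moreover have "int k \<le> int k * int n"
      using mult_left_mono[of 1 "int n" "int k"] n(2) by simp
    ultimately have "k \<le> level r1 f1"
      unfolding n(1) by linarith
    from root_shift[OF assms(1) f1(1) this]
    obtain f2 where f2: "f2 \<in> D" "\<And>x. x \<in> X \<Longrightarrow> f2 x * den r1 x ^ k = f1 x * num r1 x ^ k"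
      by blast
    have "f2 x * den r x ^ k = f x * num r x ^ k" if x: "x \<in> X" for x
    proof -
      have "f2 x * den r x ^ k = (f2 x * den r1 x ^ k) * den r2 x ^ k"
        by (simp add: r_def power_mult_distrib mult.assoc)
      also have "\<dots> = (f1 x * den r2 x ^ k) * num r1 x ^ k"
        by (simp add: f2(2)[OF x] mult_ac)
      also have "\<dots> = f x * num r x ^ k"
        by (simp add: f1(2)[OF x] r_def power_mult_distrib mult_ac)
      finally show ?thesis .
    qed
    with f2(1) show ?thesis
      by blast
  qed
  ultimately have "is_root r"
    using D by (auto simp: is_root_def r_def intro: mult_D)
  moreover have "level r = level r2"
    by (simp add: r_def)
  moreover have "pairing r' r = pairing r' r1 + pairing r' r2" if "is_root r'" for r'
    using that D by (simp add: r_def pairing_def level_mult)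
  ultimately show thesis
    using that by blast
qed

text \<open>A path from \<open>i\<close> to \<open>j\<close> is compressed to one root with the ray
  of \<open>R j\<close> and positive pairing against \<open>R i\<close>, by taking a commutator at
  each step. For a closed path this root lies on the ray of \<open>R i\<close> and so pairs to -1
  with it.\<close>

lemma acyclic_pairing:
  assumes roots: "\<And>i. i \<in> I \<Longrightarrow> is_root (R i)"
    and no_pair: "\<And>r r'. is_root r \<Longrightarrow> is_root r' \<Longrightarrow> pairing r r' > 0 \<Longrightarrow> pairing r' r \<le> 0"
  shows "acyclic {(i, j) \<in> I \<times> I. pairing (R i) (R j) > 0}"
proof -
  let ?E = "{(i, j) \<in> I \<times> I. pairing (R i) (R j) > 0}"
  have path: "i \<in> I \<and> j \<in> I \<and> (\<exists>r. is_root r \<and> level r = level (R j) \<and> pairing (R i) r > 0)"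
    if "(i, j) \<in> ?E\<^sup>+" for i j
    using that
  proof (induction rule: trancl_induct)
    case (base j)
    then show ?case
      using roots by auto
  next
    case (step j k)
    then obtain r where r: "is_root r" "level r = level (R j)" "pairing (R i) r > 0"
      by blast
    from step have ijk: "i \<in> I" "j \<in> I" "k \<in> I" "pairing (R j) (R k) > 0"
      by auto
    have rk: "pairing r (R k) > 0"
      using ijk(4) r(2) by (simp add: pairing_def)
    \<comment> \<open>The commutator needs this pairing to be 0. Mutual positivity is excluded, and
      a negative value would put both roots on one ray, where the pairing in \<open>rk\<close> would
      be -1.\<close>
    have "pairing (R k) r \<le> 0"
      using no_pair[OF r(1) roots[OF ijk(3)] rk] .
    moreover have "\<not> pairing (R k) r < 0"
    proof
      assume "pairing (R k) r < 0"
      note eq = pairing_neg_imp_level_eq[OF roots[OF ijk(3)] r(1) this]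
      have "pairing r (R k) = -1"
        using eq[OF den_D[OF roots[OF ijk(3)]]] eq[OF num_D[OF roots[OF ijk(3)]]]
          level_den[OF roots[OF ijk(3)]] by (simp add: pairing_def)
      with rk show False
        by simp
    qed
    ultimately have kr: "pairing (R k) r = 0"
      by linarith
    obtain r' where r': "is_root r'" "level r' = level (R k)"
      "pairing (R i) r' = pairing (R i) r + pairing (R i) (R k)"
      using commutator_root[OF r(1) roots[OF ijk(3)] rk kr] roots[OF ijk(1)] by metis
    \<comment> \<open>A negative value would identify the rays of \<open>R i\<close> and
      \<open>R k\<close>, and then \<open>pairing (R i) r\<close> would be 0 by
      \<open>kr\<close>.\<close>
    have "pairing (R i) (R k) \<ge> 0"
    proof (rule ccontr)
      assume "\<not> pairing (R i) (R k) \<ge> 0"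
      then have "pairing (R i) (R k) < 0"
        by simp
      note eq = pairing_neg_imp_level_eq[OF roots[OF ijk(1)] roots[OF ijk(3)] this]
      have "pairing (R i) r = pairing (R k) r"
        using eq den_D[OF r(1)] num_D[OF r(1)] by (simp add: pairing_def)
      with kr r(3) show False
        by simp
    qed
    with r(3) r' ijk show ?case
      by auto
  qed
  show ?thesis
    unfolding acyclic_def
  proof safe
    fix i assume "(i, i) \<in> ?E\<^sup>+"
    from path[OF this] obtain r where "i \<in> I" "is_root r" "level r = level (R i)" "pairing (R i) r > 0"
      by blast
    then show False
      using pairing_self[of "R i" r] roots by simp
  qed
qed

end

section \<open>The acyclic case\<close>

text \<open>Products and inverses in a subgroup are those of the ambient group, so words may be
  evaluated in \<open>G\<close>.\<close>

lemma (in group) generate_free_pair: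
  assumes "g \<in> carrier G" "h \<in> carrier G" "g \<noteq> h"
    and "\<And>w. w \<noteq> [] \<Longrightarrow> fst ` set w \<subseteq> {g, h} \<Longrightarrow> reduced_word w \<Longrightarrow> word_value G w \<noteq> \<one>"
  shows "\<exists>H. subgroup H G \<and> free_group_of_rank (G\<lparr>carrier := H\<rparr>) 2"
proof (intro exI conjI)
  let ?H = "generate G {g, h}" let ?G = "G\<lparr>carrier := ?H\<rparr>"
  show H: "subgroup ?H G"
    using assms by (intro generate_is_subgroup) auto
  have sub: "{g, h} \<subseteq> ?H"
    by (auto intro: generate.incl)
  have "word_value ?G w = word_value G w" if "fst ` set w \<subseteq> {g, h}" for w
  proof -
    have "inv\<^bsub>?G\<^esub> b = inv b" if "b \<in> {g, h}" for b
      using m_inv_consistent[OF H] sub that by blast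
    with that show ?thesis
      by (induction w) (auto simp: word_value_def)
  qed
  moreover have "generate ?G {g, h} = ?H"
    by (rule generate_consistent[OF sub H])
  ultimately have "free_basis ?G {g, h}"
    using assms(4) sub by (auto simp: free_basis_def)
  then show "free_group_of_rank ?G 2"
    unfolding free_group_of_rank_def using subgroup_imp_group[OF H] assms(3)
    by (intro conjI exI[of _ "{g, h}"]) auto
qed

text \<open>Remove a sink \<open>s\<close> of the positivity graph: all \<open>a s j\<close> are
  nonpositive and \<open>a s s < 0\<close>. Weights for the remaining indices come by induction; a
  large weight on \<open>s\<close> makes column \<open>s\<close> negative and cannot increase the
  other columns.\<close>

lemma acyclic_weights:
  fixes a :: "'i \<Rightarrow> 'i \<Rightarrow> int"
  assumes "finite I" "\<And>i. i \<in> I \<Longrightarrow> a i i < 0" "acyclic {(i, j) \<in> I \<times> I. a i j > 0}"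
  shows "\<exists>N :: 'i \<Rightarrow> nat. \<forall>j\<in>I. (\<Sum>i\<in>I. int (N i) * a i j) < 0"
  using assms
proof (induction "card I" arbitrary: I)
  case 0
  then show ?case
    by simp
next
  case (Suc n)
  let ?E = "\<lambda>I. {(i, j) \<in> I \<times> I. a i j > 0}"
  have wf: "wf ((?E I)\<inverse>)"
    using Suc.prems by (intro finite_acyclic_wf_converse finite_subset[of "?E I" "I \<times> I"]) auto
  obtain i where "i \<in> I"
    using Suc.hyps by fastforce
  from wfE_min[OF wf this] obtain s where s: "s \<in> I" "\<And>j. (j, s) \<in> (?E I)\<inverse> \<Longrightarrow> j \<notin> I"
    by blast
  have s_le: "a s j \<le> 0" if "j \<in> I" for j
  proof (rule ccontr)
    assume "\<not> a s j \<le> 0"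
    with s(1) that have "(j, s) \<in> (?E I)\<inverse>"
      by simp
    with s(2) that show False
      by blast
  qed
  let ?J = "I - {s}"
  have "acyclic (?E ?J)"
    using Suc.prems(3) by (rule acyclic_subset) auto
  moreover have "n = card ?J"
    using Suc.hyps(2) Suc.prems(1) s(1) by simp
  ultimately have "\<exists>N :: 'i \<Rightarrow> nat. \<forall>j\<in>?J. (\<Sum>i\<in>?J. int (N i) * a i j) < 0"
    using Suc.prems by (intro Suc.hyps(1)) auto
  then obtain N :: "'i \<Rightarrow> nat" where N: "\<And>j. j \<in> ?J \<Longrightarrow> (\<Sum>i\<in>?J. int (N i) * a i j) < 0"
    by blast
  \<comment> \<open>One more than the size of what the other weights contribute to column
    \<open>s\<close>.\<close>
  define M where "M = nat (1 + \<bar>\<Sum>i\<in>?J. int (N i) * a i s\<bar>)"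
  define N' where "N' = N(s := M)"
  have split: "(\<Sum>i\<in>I. int (N' i) * a i j) = int M * a s j + (\<Sum>i\<in>?J. int (N i) * a i j)" for j
    using Suc.prems(1) s(1) by (simp add: sum.remove[of I s] N'_def)
  have "(\<Sum>i\<in>I. int (N' i) * a i j) < 0" if "j \<in> I" for j
  proof (cases "j = s")
    case True
    have "int M * a s s \<le> int M * (-1)"
      using Suc.prems(2)[OF s(1)] by (intro mult_left_mono) auto
    then show ?thesis
      unfolding True split by (simp add: M_def)
  next
    case False
    then show ?thesis
      using split[of j] N[of j] s_le[OF that] that mult_nonneg_nonpos[of "int M" "a s j"] by simp
  qed
  then show ?case
    by blast
qed

context semi_invariants
begin

text \<open>Binomial expansion of \<open>f * (1 + a * slope r) ^ level r f\<close>, with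
  \<open>f * slope r ^ k\<close> replaced by the regular function \<open>F k\<close>. It is checked
  generically after multiplication by a power of \<open>den r\<close> and then holds
  everywhere.\<close>

lemma grp_expansion:
  assumes "is_root r" "f \<in> D"
  obtains F where "\<And>k. k \<le> level r f \<Longrightarrow> F k \<in> D"
    "\<And>k x. k \<le> level r f \<Longrightarrow> x \<in> X \<Longrightarrow> F k x * den r x ^ k = f x * num r x ^ k"
    "\<And>a x. x \<in> X \<Longrightarrow> f (grp r a x) = (\<Sum>k\<le>level r f. of_nat (level r f choose k) * a ^ k * F k x)"
proof -
  let ?n = "level r f"
  have "\<forall>k\<in>{..?n}. \<exists>f'. f' \<in> D \<and> (\<forall>x\<in>X. f' x * den r x ^ k = f x * num r x ^ k)"
    using assms unfolding is_root_def by blast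
  from bchoice[OF this] obtain F where F: "\<And>k. k \<le> ?n \<Longrightarrow> F k \<in> D"
    "\<And>k x. k \<le> ?n \<Longrightarrow> x \<in> X \<Longrightarrow> F k x * den r x ^ k = f x * num r x ^ k"
    by auto
  have "f (grp r a x) = (\<Sum>k\<le>?n. of_nat (?n choose k) * a ^ k * F k x)" if x: "x \<in> X" for a x
  proof -
    obtain p where p: "p \<in> P" "\<And>x. x \<in> X \<Longrightarrow> f (grp r a x) = p x"
      using regular_K[OF grp_K[OF assms(1)] D_P[OF assms(2)]] by blast
    have "p x = (\<Sum>k\<le>?n. of_nat (?n choose k) * a ^ k * F k x)"
    proof (rule generic_eq[OF p(1) _ _ x])
      show "(\<lambda>x. \<Sum>k\<le>?n. of_nat (?n choose k) * a ^ k * F k x) \<in> P"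
        by (intro sum_P mult_P const_P D_P F) auto
      show "\<forall>\<^sub>F x in generic. p x = (\<Sum>k\<le>?n. of_nat (?n choose k) * a ^ k * F k x)"
        using D_generic[OF den_D[OF assms(1)]] generic_in
      proof eventually_elim
        case (elim x)
        have "p x * den r x ^ ?n = f x * (den r x + a * num r x) ^ ?n"
          using acts_pointwise[OF grp_K[OF assms(1)] assms(1) grp_acts[OF assms(1), of a] assms(2) elim(2)]
            p(2)[OF elim(2)] by simp
        also have "\<dots> = (\<Sum>k\<le>?n. of_nat (?n choose k) * a ^ k * ((f x * num r x ^ k) * den r x ^ (?n - k)))"
          by (subst add.commute, subst binomial_ring)
            (simp add: sum_distrib_left power_mult_distrib mult_ac)
        also have "\<dots> = (\<Sum>k\<le>?n. of_nat (?n choose k) * a ^ k * (F k x * den r x ^ ?n))"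
        proof (rule sum.cong)
          fix k assume "k \<in> {..?n}"
          then have "(f x * num r x ^ k) * den r x ^ (?n - k) = F k x * (den r x ^ k * den r x ^ (?n - k))"
            using F(2)[of k x] elim(2) by (simp add: mult.assoc[symmetric])
          also have "den r x ^ k * den r x ^ (?n - k) = den r x ^ ?n"
            using \<open>k \<in> {..?n}\<close> by (simp add: power_add[symmetric])
          finally show "of_nat (?n choose k) * a ^ k * ((f x * num r x ^ k) * den r x ^ (?n - k)) =
            of_nat (?n choose k) * a ^ k * (F k x * den r x ^ ?n)" by simp
        qed simp
        also have "\<dots> = (\<Sum>k\<le>?n. of_nat (?n choose k) * a ^ k * F k x) * den r x ^ ?n"
          by (simp add: sum_distrib_right mult.assoc)
        finally show ?case
          using elim(1) by simp
      qed
    qed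
    with p(2)[OF x] show ?thesis
      by simp
  qed
  with F that show thesis
    by blast
qed

lemma acyclic_not_doubly_transitive:
  assumes "finite I" and roots: "\<And>i. i \<in> I \<Longrightarrow> is_root (R i)"
    and K: "K = generate (BijGroup X) (\<Union>i\<in>I. range (grp (R i)))"
    and acyclic: "acyclic {(i, j) \<in> I \<times> I. pairing (R i) (R j) > 0}"
    and S: "S \<subseteq> X" "\<And>g x. g \<in> K \<Longrightarrow> x \<in> S \<Longrightarrow> g x \<in> S"
    and ab: "a \<in> S" "b \<in> S" "a \<noteq> b"
    and swap: "\<And>x y. x \<in> S \<Longrightarrow> y \<in> S \<Longrightarrow> x \<noteq> y \<Longrightarrow> \<exists>g\<in>K. g x = y \<and> g y = x"
  shows False
proof -
  have "\<exists>N :: _ \<Rightarrow> nat. \<forall>j\<in>I. (\<Sum>i\<in>I. int (N i) * pairing (R i) (R j)) < 0"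
    by (rule acyclic_weights[OF assms(1) _ acyclic]) (simp add: pairing_self roots)
  then obtain N :: "_ \<Rightarrow> nat" where N: "\<And>j. j \<in> I \<Longrightarrow> (\<Sum>i\<in>I. int (N i) * pairing (R i) (R j)) < 0"
    by blast
  \<comment> \<open>By the choice of \<open>N\<close>, a shift by at least one step along any
    \<open>R j\<close> strictly lowers \<open>w\<close>.\<close>
  define w where "w f = (\<Sum>i\<in>I. N i * level (R i) f)" for f
  define nonconst where "nonconst f \<longleftrightarrow> f \<in> D \<and> (\<exists>x\<in>S. \<exists>y\<in>S. f x \<noteq> f y)" for f
  have "\<exists>f. nonconst f"
    using D_separates[of a b] ab S(1) by (auto simp: nonconst_def)
  then obtain f where f: "nonconst f" and least: "\<And>f'. nonconst f' \<Longrightarrow> w f \<le> w f'"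
    using ex_has_least_nat[of nonconst _ w] by blast
  have fD: "f \<in> D"
    using f by (simp add: nonconst_def)
  have generator: "\<exists>c. \<forall>x\<in>S. f (grp (R j) t x) = f x + c" if j: "j \<in> I" for j t
  proof -
    let ?n = "level (R j) f"
    obtain F where F: "\<And>k. k \<le> ?n \<Longrightarrow> F k \<in> D"
      "\<And>k x. k \<le> ?n \<Longrightarrow> x \<in> X \<Longrightarrow> F k x * den (R j) x ^ k = f x * num (R j) x ^ k"
      "\<And>a x. x \<in> X \<Longrightarrow> f (grp (R j) a x) = (\<Sum>k\<le>?n. of_nat (?n choose k) * a ^ k * F k x)"
      using grp_expansion[OF roots[OF j] fD] by blast
    \<comment> \<open>For \<open>k \<ge> 1\<close> the coefficient has smaller weight than
      \<open>f\<close>, so minimality makes it constant on \<open>S\<close>; its value at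
      \<open>a\<close> serves as that constant.\<close>
    have const: "F k x = F k a" if k: "k \<in> {1..?n}" and x: "x \<in> S" for k x
    proof -
      have shift: "int (level (R i) (F k)) = int (level (R i) f) + int k * pairing (R i) (R j)" if "i \<in> I" for i
        by (rule level_shift) (use roots that j fD F k in auto)
      have "int (w (F k)) = int (w f) + int k * (\<Sum>i\<in>I. int (N i) * pairing (R i) (R j))"
        by (simp add: w_def shift distrib_left sum.distrib sum_distrib_left mult.left_commute)
      also have "\<dots> < int (w f)"
        using N[OF j] k by (simp add: mult_pos_neg)
      finally have "\<not> nonconst (F k)"
        using least[of "F k"] by auto
      then show ?thesis
        using F(1)[of k] k x ab(1) unfolding nonconst_def by fastforce
    qed
    have "f (grp (R j) t x) = f x + (\<Sum>k=1..?n. of_nat (?n choose k) * t ^ k * F k a)" if x: "x \<in> S" for x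
    proof -
      have "{..?n} = insert 0 {1..?n}"
        by auto
      with S(1) x have "f (grp (R j) t x) = F 0 x + (\<Sum>k=1..?n. of_nat (?n choose k) * t ^ k * F k x)"
        using F(3)[of x t] by (simp add: subset_iff)
      also have "(\<Sum>k=1..?n. of_nat (?n choose k) * t ^ k * F k x) = (\<Sum>k=1..?n. of_nat (?n choose k) * t ^ k * F k a)"
        using const x by (intro sum.cong) auto
      finally show ?thesis
        using F(2)[of 0 x] S(1) x by auto
    qed
    then show ?thesis
      by blast
  qed
  have "\<exists>c. \<forall>x\<in>S. f (g x) = f x + c" if "g \<in> K" for g
    using that unfolding K
  proof (induction rule: generate.induct)
    case one
    show ?case
      using S(1) by (auto simp: BijGroup_def subset_iff)
  next
    case (incl h)
    then show ?case
      using generator by auto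
  next
    case (inv h)
    then have hK: "h \<in> K"
      unfolding K by (rule generate.incl)
    obtain c where c: "\<And>x. x \<in> S \<Longrightarrow> f (h x) = f x + c"
      using generator inv by blast
    let ?h = "inv\<^bsub>BijGroup X\<^esub> h"
    have h: "?h = restrict (inv_into X h) X"
      using K_Bij[OF hK] by (simp add: inv_BijGroup restrict_def)
    have "f (?h x) = f x + - c" if x: "x \<in> S" for x
    proof -
      have "?h x \<in> S"
        using S(2)[OF K_inv[OF hK] x] unfolding h .
      from c[OF this] show ?thesis
        using K_inv_right[OF hK] S(1) x unfolding h by (auto simp: subset_iff)
    qed
    then show ?case
      by blast
  next
    case (eng h1 h2)
    then have hK: "h1 \<in> K" "h2 \<in> K"
      unfolding K by auto
    obtain c1 c2 where c: "\<And>x. x \<in> S \<Longrightarrow> f (h1 x) = f x + c1" "\<And>x. x \<in> S \<Longrightarrow> f (h2 x) = f x + c2"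
      using eng.IH by blast
    have "f ((h1 \<otimes>\<^bsub>BijGroup X\<^esub> h2) x) = f x + (c2 + c1)" if x: "x \<in> S" for x
      using c(1)[OF S(2)[OF hK(2) x]] c(2)[OF x] K_Bij[OF hK(1)] K_Bij[OF hK(2)] S(1) x
      by (auto simp: BijGroup_def compose_eq subset_iff)
    then show ?case
      by blast
  qed
  moreover obtain x y where xy: "x \<in> S" "y \<in> S" "f x \<noteq> f y"
    using f by (auto simp: nonconst_def)
  moreover from this obtain g where g: "g \<in> K" "g x = y" "g y = x"
    using swap[of x y] by auto
  ultimately obtain c where "f y = f x + c" "f x = f y + c"
    by metis
  \<comment> \<open>The swap translates \<open>f\<close> by one constant that equals both
    \<open>f y - f x\<close> and \<open>f x - f y\<close>.\<close>
  then have "2 * f x = 2 * f y"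
    by (simp add: algebra_simps)
  with xy(3) show False
    by simp
qed

section \<open>Ping-pong\<close>

text \<open>\<open>Y\<close> and \<open>Z\<close> are the inverse slopes, normalized to 1 at
  \<open>x0\<close>. Recording them as rational numbers supplies the order and the absolute value
  that ping-pong needs.\<close>

definition coords :: "('x, 'k) root \<Rightarrow> ('x, 'k) root \<Rightarrow> 'x \<Rightarrow> rat \<Rightarrow> rat \<Rightarrow> bool" where
  "coords r r' x Y Z \<longleftrightarrow> x \<in> X \<and> den r x \<noteq> 0 \<and> num r x \<noteq> 0 \<and> den r' x \<noteq> 0 \<and> num r' x \<noteq> 0 \<and>
    slope r x * of_rat Y = slope r x0 \<and> slope r' x * of_rat Z = slope r' x0"

lemma coords_sym: "coords r r' x Y Z \<longleftrightarrow> coords r' r x Z Y"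
  by (auto simp: coords_def)

lemma slope_x0: "is_root r \<Longrightarrow> slope r x0 \<noteq> 0"
  using D_nonzero den_D num_D by (simp add: slope_def)

lemma coords_x0: "is_root r \<Longrightarrow> is_root r' \<Longrightarrow> coords r r' x0 Y Z \<longleftrightarrow> Y = 1 \<and> Z = 1"
  using D_nonzero den_D num_D slope_x0 x0 by (auto simp: coords_def)

lemma coords_unique:
  assumes "is_root r" "is_root r'" "coords r r' x Y Z" "coords r r' x Y' Z'"
  shows "Y = Y'"
proof -
  have "slope r x * of_rat Y = slope r x * of_rat Y'" "slope r x \<noteq> 0"
    using assms(3,4) by (auto simp: coords_def slope_def)
  then show ?thesis
    by simp
qed

text \<open>The factor \<open>u = 1 + c / Y\<close> is rational. It divides \<open>slope r\<close>,
  so \<open>Y\<close> is translated by \<open>c\<close>, and its \<open>b\<close>-th power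
  multiplies \<open>slope r'\<close>, so \<open>Z\<close> is divided by that power.\<close>

lemma coords_step:
  assumes "is_root r" "is_root r'" "pairing r r' = int b" "coords r r' x Y Z"
    and "g \<in> K" "acts (level r) (\<lambda>x. of_rat c / slope r x0 * slope r x) g" "Y + c \<noteq> 0"
  shows "coords r r' (g x) (Y + c) (Z * (Y / (Y + c)) ^ b)"
proof -
  note x = assms(4)[unfolded coords_def]
  have Y: "Y \<noteq> 0"
    using x slope_x0[OF assms(1)] by auto
  define u where "u = (Y + c) / Y"
  have u: "u \<noteq> 0" "Y + c = Y * u" "Y / (Y + c) = 1 / u"
    using Y assms(7) by (simp_all add: u_def field_simps)
  have "slope r x \<noteq> 0"
    using x by (simp add: slope_def)
  then have "of_rat c / slope r x0 * slope r x = of_rat c / of_rat Y"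
    using x Y by (metis divide_divide_eq_left' mult.commute nonzero_mult_div_cancel_left times_divide_eq_left)
  then have "1 + of_rat c / slope r x0 * slope r x = (of_rat u :: 'k)"
    using Y by (simp add: u_def of_rat_divide of_rat_add add_divide_distrib)
  then have act: "f (g x) = f x * of_rat u ^ level r f" if "f \<in> D" for f
    using acts_at[OF assms(5,1,6) that] x by simp
  note acts = act[OF den_D[OF assms(1)]] act[OF num_D[OF assms(1)]]
    act[OF den_D[OF assms(2)]] act[OF num_D[OF assms(2)]]
  have "slope r (g x) = slope r x / of_rat u"
    using u(1) by (simp add: slope_def acts level_den[OF assms(1)])
  moreover have "level r (num r') = level r (den r') + b"
    using assms(3) by (simp add: pairing_def)
  then have "slope r' (g x) = slope r' x * of_rat u ^ b"
    using u(1) by (simp add: slope_def acts power_add)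
  ultimately show ?thesis
    unfolding coords_def u(2,3)
    using x Y u(1) K_in[OF assms(5)] acts
    by (simp add: of_rat_mult of_rat_power of_rat_divide power_divide)
qed

text \<open>A ping-pong region for one root, with \<open>\<sigma>\<close> the sign of the exponent
  of the letter applied last. The bound on \<open>Y * Z\<close> forces \<open>Z\<close> to be
  small.\<close>

definition attracted :: "('x, 'k) root \<Rightarrow> ('x, 'k) root \<Rightarrow> rat \<Rightarrow> 'x \<Rightarrow> bool" where
  "attracted r r' \<sigma> x \<longleftrightarrow> (\<exists>Y Z. coords r r' x Y Z \<and> \<sigma> * Y \<ge> 2 \<and> \<bar>Y * Z\<bar> \<le> 1)"

lemma attracted_step:
  assumes "is_root r" "is_root r'" "pairing r r' > 0" "coords r r' x Y Z" "\<bar>Y * Z\<bar> \<le> 1"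
    and "g \<in> K" "acts (level r) (\<lambda>x. of_rat (3 * \<sigma>) / slope r x0 * slope r x) g"
    and "\<sigma> = 1 \<or> \<sigma> = -1" "\<sigma> * Y \<ge> 2 \<or> \<bar>Y\<bar> \<le> 1"
  shows "attracted r r' \<sigma> (g x)"
proof -
  let ?Y = "Y + 3 * \<sigma>"
  have Y: "\<sigma> * ?Y \<ge> 2" "\<bar>Y\<bar> \<le> \<bar>?Y\<bar>"
    using assms(8,9) by auto
  then have nz: "?Y \<noteq> 0"
    by auto
  obtain b where b: "pairing r r' = int (Suc b)"
    using assms(3) by (metis zero_less_imp_eq_int gr0_implies_Suc)
  have "?Y * (Z * (Y / ?Y) ^ Suc b) = (Y * Z) * (Y / ?Y) ^ b"
    using nz by simp
  moreover have "\<bar>Y / ?Y\<bar> \<le> 1"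
    using Y(2) nz by (simp add: abs_divide divide_le_eq)
  ultimately have "\<bar>?Y * (Z * (Y / ?Y) ^ Suc b)\<bar> \<le> 1 * 1"
    unfolding abs_mult[of "Y * Z"] power_abs using assms(5)
    by (simp only: abs_mult[of "Y * Z"]) (intro mult_mono, auto intro!: power_le_one simp: power_abs)
  with coords_step[OF assms(1,2) b assms(4,6,7) nz] Y(1) show ?thesis
    unfolding attracted_def by (metis mult_1)
qed

text \<open>Ping-pong on the orbit of \<open>x0\<close>: the image of \<open>x0\<close> under a
  nonempty reduced word lies in the region named by the leftmost letter, whereas \<open>x0\<close>
  itself, with both coordinates 1, lies in none.\<close>

lemma free_pair:
  assumes r: "is_root r" "is_root r'" "pairing r r' > 0" "pairing r' r > 0"
  defines "G \<equiv> BijGroup X\<lparr>carrier := K\<rparr>"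
  shows "\<exists>H. subgroup H G \<and> free_group_of_rank (G\<lparr>carrier := H\<rparr>) 2"
proof -
  interpret G: group G
    unfolding G_def by (rule group.subgroup_imp_group[OF group_BijGroup subgroup_K])
  define g h where "g = grp r (3 / slope r x0)" and "h = grp r' (3 / slope r' x0)"
  have gh: "g \<in> K" "h \<in> K"
    using grp_K r(1,2) by (auto simp: g_def h_def)
  have inv: "inv\<^bsub>G\<^esub> b = restrict (inv_into X b) X" if "b \<in> K" for b
    using group.m_inv_consistent[OF group_BijGroup subgroup_K that] K_Bij[OF that]
    by (simp add: G_def inv_BijGroup restrict_def)
  define sgn' where "sgn' e = (if e then 1 else - 1 :: rat)" for e
  define letter where "letter b e = (if e then b else inv\<^bsub>G\<^esub> b)" for b and e :: bool
  have letter_K: "letter b e \<in> K" if "b \<in> K" for b e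
    using that K_inv by (simp add: letter_def inv)
  have acts_letter: "acts (level s) (\<lambda>x. of_rat (3 * sgn' e) / slope s x0 * slope s x)
      (letter (grp s (3 / slope s x0)) e)" if "is_root s" for s e
    using grp_acts[OF that, of "3 / slope s x0"] acts_inverse[OF grp_K[OF that] that grp_acts[OF that], of "3 / slope s x0"]
      grp_K[OF that] by (simp add: letter_def sgn'_def inv of_rat_minus)
  have carrier_G: "carrier G = K"
    by (simp add: G_def)
  have mult_G: "f \<otimes>\<^bsub>G\<^esub> f' = compose X f f'" if "f \<in> Bij X" "f' \<in> Bij X" for f f'
    using that by (simp add: G_def BijGroup_def)
  have word_Cons: "word_value G ((b, e) # w) = letter b e \<otimes>\<^bsub>G\<^esub> word_value G w" for b e w
    by (simp add: word_value_def letter_def)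
  have value_K: "word_value G w \<in> K" if "fst ` set w \<subseteq> K" for w
    using that
  proof (induction w)
    case Nil
    then show ?case
      using G.one_closed by (simp add: word_value_def carrier_G)
  next
    case (Cons l w)
    then show ?case
      using G.m_closed[of "letter (fst l) (snd l)" "word_value G w"] letter_K
      by (cases l) (simp add: word_Cons carrier_G)
  qed
  have value_Cons: "word_value G ((b, e) # w) x0 = letter b e (word_value G w x0)"
    if "b \<in> K" "fst ` set w \<subseteq> K" for b e w
    using K_Bij[OF letter_K[OF that(1), of e]] K_Bij[OF value_K[OF that(2)]] x0
    by (simp add: word_Cons mult_G compose_eq)
  have sgn: "sgn' e = 1 \<or> sgn' e = - 1" for e
    by (simp add: sgn'_def)
  \<comment> \<open>The three cases for \<open>x\<close> are the start, a preceding letter with the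
    same base and hence, in a reduced word, the same exponent, and a preceding letter with the other
    base.\<close>
  have push: "attracted s s' (sgn' e) (letter (grp s (3 / slope s x0)) e x)"
    if "is_root s" "is_root s'" "pairing s s' > 0"
      "x = x0 \<or> attracted s s' (sgn' e) x \<or> attracted s' s (sgn' e') x" for s s' e e' x
  proof -
    have "\<exists>Y Z. coords s s' x Y Z \<and> \<bar>Y * Z\<bar> \<le> 1 \<and> (sgn' e * Y \<ge> 2 \<or> \<bar>Y\<bar> \<le> 1)"
      using that(4)
    proof (elim disjE)
      assume "x = x0"
      then show ?thesis
        using coords_x0[OF that(1,2)] by (intro exI[of _ 1]) simp
    next
      assume "attracted s s' (sgn' e) x"
      then show ?thesis
        unfolding attracted_def by blast
    next
      assume "attracted s' s (sgn' e') x"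
      then obtain Z Y where ZY: "coords s s' x Y Z" "sgn' e' * Z \<ge> 2" "\<bar>Y * Z\<bar> \<le> 1"
        unfolding attracted_def by (metis coords_sym mult.commute)
      \<comment> \<open>After a letter with the other base \<open>Z\<close> is large, so the bound
        on \<open>Y * Z\<close> makes \<open>Y\<close> small.\<close>
      have "\<bar>Z\<bar> \<ge> 1"
        using ZY(2) sgn[of e'] by auto
      then have "\<bar>Y\<bar> * 1 \<le> \<bar>Y\<bar> * \<bar>Z\<bar>"
        by (intro mult_left_mono) auto
      then have "\<bar>Y\<bar> \<le> 1"
        using ZY(3) by (simp add: abs_mult)
      with ZY show ?thesis
        by blast
    qed
    then show ?thesis
      using attracted_step[OF that(1-3) _ _ letter_K[OF grp_K[OF that(1)]] acts_letter[OF that(1)] sgn] by blast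
  qed
  \<comment> \<open>In both regions at once, both coordinates would have size at least 2, against
    the bound 1 on their product.\<close>
  have disjoint: "\<not> attracted r' r (sgn' e') x" if "attracted r r' (sgn' e) x" for x e e'
  proof
    assume "attracted r' r (sgn' e') x"
    with that obtain Y Z Y' Z' where YZ: "coords r r' x Y Z" "sgn' e * Y \<ge> 2" "\<bar>Y * Z\<bar> \<le> 1"
      "coords r' r x Z' Y'" "sgn' e' * Z' \<ge> 2"
      unfolding attracted_def by blast
    have "Z' = Z"
      using coords_unique[OF r(2,1) YZ(4)] YZ(1) coords_sym by blast
    with YZ(2,5) sgn[of e] sgn[of e'] have "\<bar>Y\<bar> \<ge> 2" "\<bar>Z\<bar> \<ge> 2"
      by auto
    then have "2 * 2 \<le> \<bar>Y\<bar> * \<bar>Z\<bar>"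
      by (intro mult_mono) auto
    with YZ(3) show False
      by (simp add: abs_mult)
  qed
  have "attracted r r' (sgn' True) (letter g True x0)" "attracted r' r (sgn' True) (letter h True x0)"
    unfolding g_def h_def using push r by blast+
  with disjoint have neq: "g \<noteq> h"
    by auto
  have ping_pong: "(b = g \<longrightarrow> attracted r r' (sgn' e) (word_value G ((b, e) # w) x0)) \<and>
      (b = h \<longrightarrow> attracted r' r (sgn' e) (word_value G ((b, e) # w) x0))"
    if "b \<in> {g, h}" "fst ` set w \<subseteq> {g, h}" "reduced_word ((b, e) # w)" for b e w
    using that
  proof (induction w arbitrary: b e)
    case Nil
    have "word_value G [] x0 = x0"
      using x0 by (simp add: word_value_def G_def BijGroup_def)
    then have "word_value G [(b, e)] x0 = letter b e x0"
      using value_Cons[of b "[]" e] Nil gh by auto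
    then show ?case
      using push[OF r(1,2,3)] push[OF r(2,1,4)] unfolding g_def h_def by auto
  next
    case (Cons l w)
    obtain b' e' where l: "l = (b', e')"
      by fastforce
    let ?y = "word_value G ((b', e') # w) x0"
    have red: "reduced_word ((b', e') # w)" "b = b' \<Longrightarrow> e = e'"
      using Cons.prems(3) by (auto simp: reduced_word_def l)
    have b': "b' \<in> {g, h}" "fst ` set w \<subseteq> {g, h}"
      using Cons.prems(2) by (auto simp: l)
    note IH = Cons.IH[OF b' red(1)]
    have step: "word_value G ((b, e) # l # w) x0 = letter b e ?y"
      using value_Cons[of b "l # w" e] Cons.prems gh unfolding l by auto
    have "attracted r r' (sgn' e) ?y \<or> attracted r' r (sgn' e') ?y" if "b = g"
      using IH red(2) b'(1) that by auto
    moreover have "attracted r' r (sgn' e) ?y \<or> attracted r r' (sgn' e') ?y" if "b = h"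
      using IH red(2) b'(1) that by auto
    ultimately show ?case
      unfolding step using push[OF r(1,2,3)] push[OF r(2,1,4)] unfolding g_def h_def by blast
  qed
  show ?thesis
  proof (rule G.generate_free_pair[OF _ _ neq])
    show "g \<in> carrier G" "h \<in> carrier G"
      using gh by (simp_all add: G_def)
    fix w :: "(('x \<Rightarrow> 'x) \<times> bool) list"
    assume w: "w \<noteq> []" "fst ` set w \<subseteq> {g, h}" "reduced_word w"
    obtain b e v where "w = (b, e) # v"
      using w(1) by (metis neq_Nil_conv surj_pair)
    with ping_pong[of b v e] w
    have attr: "attracted r r' (sgn' e) (word_value G w x0) \<or> attracted r' r (sgn' e) (word_value G w x0)"
      by auto
    have "\<not> attracted s s' (sgn' e) x0" if "is_root s" "is_root s'" for s s'
      using sgn[of e] by (auto simp: attracted_def coords_x0[OF that])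
    with attr r(1,2) have "word_value G w x0 \<noteq> x0"
      by auto
    then show "word_value G w \<noteq> \<one>\<^bsub>G\<^esub>"
      using x0 by (auto simp: G_def BijGroup_def)
  qed
qed

end

section \<open>Regular functions and automorphisms\<close>

lemma regular_map_comp:
  assumes "regular_map (function_algebra F) Y m \<psi>" "p \<in> polynomial_functions m"
  shows "\<exists>q\<in>function_algebra F. \<forall>y\<in>Y. p (\<psi> y) = q y"
  using assms(2) unfolding polynomial_functions_def
proof (induction rule: function_algebra.induct)
  case (const c)
  show ?case
    by (intro bexI[of _ "\<lambda>_. c"] function_algebra.const) simp
next
  case (gen f)
  then show ?case
    using assms(1) by (auto simp: regular_map_def)
next
  case (add f g)
  then obtain p q where "p \<in> function_algebra F" "\<forall>y\<in>Y. f (\<psi> y) = p y"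
    "q \<in> function_algebra F" "\<forall>y\<in>Y. g (\<psi> y) = q y"
    by blast
  then show ?case
    by (intro bexI[of _ "\<lambda>y. p y + q y"] function_algebra.add) auto
next
  case (mult f g)
  then obtain p q where "p \<in> function_algebra F" "\<forall>y\<in>Y. f (\<psi> y) = p y"
    "q \<in> function_algebra F" "\<forall>y\<in>Y. g (\<psi> y) = q y"
    by blast
  then show ?case
    by (intro bexI[of _ "\<lambda>y. p y * q y"] function_algebra.mult) auto
qed

lemma affine_variety_subset: "affine_variety m X \<Longrightarrow> X \<subseteq> affine_space m"
  by (auto simp: affine_variety_def zariski_closed_def)

lemma function_domain_affine_variety:
  fixes X :: "(nat \<Rightarrow> 'k::field_char_0) set"
  assumes "affine_variety m X"
  shows "function_domain X (polynomial_functions m)"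
proof
  fix p q :: "(nat \<Rightarrow> 'k) \<Rightarrow> 'k"
  assume pq: "p \<in> polynomial_functions m" "q \<in> polynomial_functions m" "\<forall>x\<in>X. p x * q x = 0"
  have closed: "zariski_closed m {x \<in> affine_space m. f x = 0}" if "f \<in> polynomial_functions m" for f :: "(nat \<Rightarrow> 'k) \<Rightarrow> 'k"
    unfolding zariski_closed_def using that by (intro exI[of _ "{f}"]) auto
  have "X \<subseteq> {x \<in> affine_space m. p x = 0} \<union> {x \<in> affine_space m. q x = 0}"
    using affine_variety_subset[OF assms] pq(3) by auto
  then have "X \<subseteq> {x \<in> affine_space m. p x = 0} \<or> X \<subseteq> {x \<in> affine_space m. q x = 0}"
    using assms closed[OF pq(1)] closed[OF pq(2)] unfolding affine_variety_def by blast
  then show "(\<forall>x\<in>X. p x = 0) \<or> (\<forall>x\<in>X. q x = 0)"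
    by auto
next
  show "X \<noteq> {}"
    using assms by (simp add: affine_variety_def)
qed (auto simp: polynomial_functions_def intro: function_algebra.intros)

lemma subgroup_aut_group:
  fixes X :: "(nat \<Rightarrow> 'k::field) set"
  shows "subgroup (carrier (aut_group m X)) (BijGroup X)"
proof -
  let ?A = "carrier (aut_group m X)" and ?reg = "regular_map (polynomial_functions m) X m"
  have A: "f \<in> ?A \<longleftrightarrow> f \<in> Bij X \<and> ?reg f \<and> ?reg (inv_into X f)" for f
    by (simp add: aut_group_def)
  have cong: "?reg f \<longleftrightarrow> ?reg g" if "\<And>x. x \<in> X \<Longrightarrow> f x = g x" for f g
    using that by (simp add: regular_map_def)
  have comp: "?reg (\<lambda>x. f (g x))" if "?reg f" "?reg g" "\<And>x. x \<in> X \<Longrightarrow> g x \<in> X" for f g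
    unfolding regular_map_def
  proof (intro allI impI)
    fix j assume "j < m"
    with that(1) obtain p where p: "p \<in> polynomial_functions m" "\<forall>x\<in>X. f x j = p x"
      by (auto simp: regular_map_def)
    from regular_map_comp[OF that(2)[unfolded polynomial_functions_def] p(1)] p(2) that(3)
    show "\<exists>q\<in>polynomial_functions m. \<forall>x\<in>X. f (g x) j = q x"
      by (auto simp: polynomial_functions_def)
  qed
  have id: "?reg (\<lambda>x. x)"
    by (auto simp: regular_map_def polynomial_functions_def intro!: bexI[of _ "\<lambda>x. x _"] function_algebra.gen)
  interpret B: group "BijGroup X"
    by (rule group_BijGroup)
  show ?thesis
  proof
    show "?A \<subseteq> carrier (BijGroup X)"
      by (auto simp: A BijGroup_def)
  next
    have "inv_into X (\<lambda>x\<in>X. x) x = x" if "x \<in> X" for x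
      using that by (intro inv_into_f_eq) (auto simp: inj_on_def)
    then show "\<one>\<^bsub>BijGroup X\<^esub> \<in> ?A"
      using id cong[of "\<lambda>x\<in>X. x" "\<lambda>x. x"] cong[of "inv_into X (\<lambda>x\<in>X. x)" "\<lambda>x. x"]
      by (simp add: A id_Bij BijGroup_def)
  next
    fix f g assume "f \<in> ?A" "g \<in> ?A"
    then have fg: "f \<in> Bij X" "g \<in> Bij X" "?reg f" "?reg g" "?reg (inv_into X f)" "?reg (inv_into X g)"
      by (auto simp: A)
    have bij: "bij_betw f X X" "bij_betw g X X"
      using fg(1,2) by (auto simp: Bij_def)
    have "inv_into X (compose X f g) x = inv_into X g (inv_into X f x)" if "x \<in> X" for x
    proof (rule inv_into_f_eq)
      show "inj_on (compose X f g) X"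
        using compose_Bij[OF fg(1,2)] by (auto simp: Bij_def bij_betw_def)
      show "inv_into X g (inv_into X f x) \<in> X"
        by (intro Bij_inv_into_mem fg(1,2) that)
      show "compose X f g (inv_into X g (inv_into X f x)) = x"
        using Bij_inv_into_mem[OF fg(1) that] Bij_inv_into_mem[OF fg(2)] bij that
        by (simp add: compose_eq bij_betw_inv_into_right)
    qed
    then have "?reg (inv_into X (compose X f g))"
      using comp[OF fg(6,5)] Bij_inv_into_mem[OF fg(1)]
        cong[of "inv_into X (compose X f g)" "\<lambda>x. inv_into X g (inv_into X f x)"] by blast
    moreover have "?reg (compose X f g)"
      using comp[OF fg(3,4)] Bij_imp_funcset[OF fg(2)] cong[of "compose X f g" "\<lambda>x. f (g x)"]
      by (auto simp: compose_eq)
    ultimately show "f \<otimes>\<^bsub>BijGroup X\<^esub> g \<in> ?A"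
      using fg(1,2) compose_Bij by (auto simp: A BijGroup_def)
  next
    fix f assume "f \<in> ?A"
    then have f: "f \<in> Bij X" "?reg f" "?reg (inv_into X f)"
      by (auto simp: A)
    let ?g = "\<lambda>x\<in>X. inv_into X f x"
    have g: "?g \<in> Bij X"
      by (rule restrict_inv_into_Bij[OF f(1)])
    have "inv_into X ?g x = f x" if "x \<in> X" for x
    proof (rule inv_into_f_eq)
      show "inj_on ?g X"
        using g by (auto simp: Bij_def bij_betw_def)
      show "f x \<in> X"
        using Bij_imp_funcset[OF f(1)] that by auto
      then show "?g (f x) = x"
        using f(1) that by (simp add: Bij_def bij_betw_def)
    qed
    then have "?reg (inv_into X ?g)"
      using f(2) cong by blast
    moreover have "?reg ?g"
      using f(3) cong[of ?g "inv_into X f"] by simp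
    ultimately show "inv\<^bsub>BijGroup X\<^esub> f \<in> ?A"
      using g by (simp add: A inv_BijGroup[OF f(1)])
  qed
qed

lemma aut_group_eq: "aut_group m X = BijGroup X\<lparr>carrier := carrier (aut_group m X)\<rparr>"
  by (simp add: aut_group_def)

lemma group_aut_group: "group (aut_group m X)"
  using group.subgroup_imp_group[OF group_BijGroup subgroup_aut_group] aut_group_eq by metis

text \<open>The uniform degree bound matters: later the largest \<open>k\<close> whose coefficient
  is not identically zero on \<open>X\<close> is taken.\<close>

lemma Ga_product_expansion:
  fixes p :: "'k::field_char_0 \<times> (nat \<Rightarrow> 'k) \<Rightarrow> 'k"
  assumes "p \<in> Ga_product_functions m"
  shows "\<exists>r N. (\<forall>k. (\<lambda>x. coeff (r x) k) \<in> polynomial_functions m) \<and>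
    (\<forall>x. degree (r x) \<le> N) \<and> (\<forall>a x. p (a, x) = poly (r x) a)"
  using assms unfolding Ga_product_functions_def
proof (induction rule: function_algebra.induct)
  case (const c)
  show ?case
    by (rule exI[of _ "\<lambda>x. [:c:]"], rule exI[of _ 0])
      (auto simp: polynomial_functions_def coeff_pCons split: nat.split intro: function_algebra.const)
next
  case (gen f)
  then show ?case
  proof
    assume "f \<in> {\<lambda>(a, x). a}"
    then show ?thesis
      by (intro exI[of _ "\<lambda>x. [:0, 1:]"] exI[of _ 1])
        (auto simp: polynomial_functions_def coeff_pCons split: nat.split intro: function_algebra.const)
  next
    assume "f \<in> (\<lambda>j (a, x). x j) ` {..<m}"
    then obtain j where "j < m" "f = (\<lambda>(a, x). x j)"
      by auto
    moreover have "(\<lambda>x. coeff [:x j:] k) \<in> polynomial_functions m" for k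
      using \<open>j < m\<close> by (cases k)
        (auto simp: polynomial_functions_def intro: function_algebra.const function_algebra.gen)
    ultimately show ?thesis
      by (intro exI[of _ "\<lambda>x. [:x j:]"] exI[of _ 0]) auto
  qed
next
  case (add f g)
  then obtain r N s M where r: "\<And>k. (\<lambda>x. coeff (r x) k) \<in> polynomial_functions m"
    "\<And>x. degree (r x) \<le> N" "\<And>a x. f (a, x) = poly (r x) a"
    and s: "\<And>k. (\<lambda>x. coeff (s x) k) \<in> polynomial_functions m"
    "\<And>x. degree (s x) \<le> M" "\<And>a x. g (a, x) = poly (s x) a"
    by blast
  have "degree (r x + s x) \<le> max N M" for x
    using r(2)[of x] s(2)[of x] degree_add_le_max[of "r x" "s x"] by linarith
  then show ?case
    using r s by (intro exI[of _ "\<lambda>x. r x + s x"] exI[of _ "max N M"])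
      (auto simp: polynomial_functions_def intro: function_algebra.add)
next
  case (mult f g)
  then obtain r N s M where r: "\<And>k. (\<lambda>x. coeff (r x) k) \<in> polynomial_functions m"
    "\<And>x. degree (r x) \<le> N" "\<And>a x. f (a, x) = poly (r x) a"
    and s: "\<And>k. (\<lambda>x. coeff (s x) k) \<in> polynomial_functions m"
    "\<And>x. degree (s x) \<le> M" "\<And>a x. g (a, x) = poly (s x) a"
    by blast
  have sum: "(\<lambda>x. \<Sum>i\<in>I. h i x) \<in> polynomial_functions m"
    if "\<And>i. h i \<in> polynomial_functions m" "finite I" for h :: "nat \<Rightarrow> (nat \<Rightarrow> 'k) \<Rightarrow> 'k" and I
    using that(2,1) by (induction I rule: finite_induct)
      (auto simp: polynomial_functions_def intro: function_algebra.const function_algebra.add)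
  have "(\<lambda>x. coeff (r x * s x) k) \<in> polynomial_functions m" for k
    unfolding coeff_mult using r(1) s(1)
    by (intro sum) (auto simp: polynomial_functions_def intro: function_algebra.mult)
  moreover have "degree (r x * s x) \<le> N + M" for x
    using r(2)[of x] s(2)[of x] degree_mult_le[of "r x" "s x"] by linarith
  ultimately show ?case
    using r(3) s(3) by (intro exI[of _ "\<lambda>x. r x * s x"] exI[of _ "N + M"]) auto
qed

section \<open>Characters of the torus\<close>

text \<open>Extensionality makes two characters equal as soon as they agree on the torus, so a set
  of characters has no hidden repetitions.\<close>

definition torus_character :: "nat \<Rightarrow> ((nat \<Rightarrow> 'k::field) \<Rightarrow> 'k) \<Rightarrow> bool" where
  "torus_character n \<chi> \<longleftrightarrow> \<chi> \<in> extensional (carrier (torus n)) \<and> \<chi> \<one>\<^bsub>torus n\<^esub> = 1 \<and>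
    (\<forall>s\<in>carrier (torus n). \<forall>t\<in>carrier (torus n). \<chi> (s \<otimes>\<^bsub>torus n\<^esub> t) = \<chi> s * \<chi> t)"

text \<open>A character may be used several times in building a sum; equal characters are merged in
  \<open>character_sums_collect\<close>.\<close>

inductive_set character_sums :: "nat \<Rightarrow> nat \<Rightarrow> ((nat \<Rightarrow> 'k::field) \<Rightarrow> (nat \<Rightarrow> 'k) \<Rightarrow> 'k) set"
  for n m :: nat where
  zero: "(\<lambda>_ _. 0) \<in> character_sums n m"
| summand: "torus_character n \<chi> \<Longrightarrow> c \<in> polynomial_functions m \<Longrightarrow> w \<in> character_sums n m \<Longrightarrow>
    (\<lambda>t x. \<chi> t * c x + w t x) \<in> character_sums n m"

lemma group_torus: "group (torus n :: (nat \<Rightarrow> 'k::field) monoid)"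
proof -
  have "group (Gm :: 'k monoid)"
  proof (rule groupI)
    fix x :: 'k assume "x \<in> carrier Gm"
    then show "\<exists>y\<in>carrier Gm. y \<otimes>\<^bsub>Gm\<^esub> x = \<one>\<^bsub>Gm\<^esub>"
      by (intro bexI[of _ "inverse x"]) (auto simp: Gm_def)
  qed (auto simp: Gm_def)
  then show ?thesis
    by (simp add: torus_def)
qed

lemma torus_character_restrict:
  assumes "\<chi> \<one>\<^bsub>torus n\<^esub> = 1"
    and "\<And>s t. s \<in> carrier (torus n) \<Longrightarrow> t \<in> carrier (torus n) \<Longrightarrow> \<chi> (s \<otimes>\<^bsub>torus n\<^esub> t) = \<chi> s * \<chi> t"
  shows "torus_character n (restrict \<chi> (carrier (torus n)))"
  using assms group.is_monoid[OF group_torus[where ?'k='a]]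
  by (auto simp: torus_character_def monoid.m_closed)

lemma character_sums_add:
  assumes "w \<in> character_sums n m" "w' \<in> character_sums n m"
  shows "(\<lambda>t x. w t x + w' t x) \<in> character_sums n m"
  using assms(1)
proof induction
  case zero
  then show ?case
    using assms(2) by simp
next
  case (summand \<chi> c w)
  from character_sums.summand[OF summand(1,2,4)] show ?case
    by (simp add: add.assoc)
qed

lemma character_sums_mult_term:
  assumes "torus_character n \<chi>" "c \<in> polynomial_functions m" "w \<in> character_sums n m"
  shows "\<exists>v\<in>character_sums n m. \<forall>t\<in>carrier (torus n). \<forall>x. v t x = \<chi> t * c x * w t x"
  using assms(3)
proof induction
  case zero
  show ?case
    by (intro bexI[of _ "\<lambda>_ _. 0"] character_sums.zero) simp
next
  case (summand \<chi>' c' w)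
  then obtain v where v: "v \<in> character_sums n m"
    "\<forall>t\<in>carrier (torus n). \<forall>x. v t x = \<chi> t * c x * w t x"
    by blast
  have "torus_character n (\<lambda>t\<in>carrier (torus n). \<chi> t * \<chi>' t)"
    using assms(1) summand(1) by (intro torus_character_restrict) (auto simp: torus_character_def)
  moreover have "(\<lambda>x. c x * c' x) \<in> polynomial_functions m"
    using assms(2) summand(2) by (auto simp: polynomial_functions_def intro: function_algebra.mult)
  ultimately have "(\<lambda>t x. (\<lambda>t\<in>carrier (torus n). \<chi> t * \<chi>' t) t * (c x * c' x) + v t x) \<in> character_sums n m"
    using v(1) by (rule character_sums.summand)
  then show ?case
    by (rule bexI[rotated]) (use v(2) in \<open>auto simp: algebra_simps\<close>)
qed

lemma character_sums_mult:
  assumes "w \<in> character_sums n m" "w' \<in> character_sums n m"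
  shows "\<exists>v\<in>character_sums n m. \<forall>t\<in>carrier (torus n). \<forall>x. v t x = w t x * w' t x"
  using assms(1)
proof induction
  case zero
  show ?case
    by (intro bexI[of _ "\<lambda>_ _. 0"] character_sums.zero) simp
next
  case (summand \<chi> c w)
  then obtain v where v: "v \<in> character_sums n m" "\<forall>t\<in>carrier (torus n). \<forall>x. v t x = w t x * w' t x"
    by blast
  obtain u where u: "u \<in> character_sums n m" "\<forall>t\<in>carrier (torus n). \<forall>x. u t x = \<chi> t * c x * w' t x"
    using character_sums_mult_term[OF summand(1,2) assms(2)] by blast
  show ?case
    by (rule bexI[OF _ character_sums_add[OF u(1) v(1)]]) (use u(2) v(2) in \<open>auto simp: algebra_simps\<close>)
qed

text \<open>Each generator is a character times a polynomial function, and such sums are closed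
  under addition and multiplication.\<close>

lemma torus_product_expansion:
  assumes "p \<in> torus_product_functions n m"
  shows "\<exists>w\<in>character_sums n m. \<forall>t\<in>carrier (torus n). \<forall>x. p (t, x) = w t x"
  using assms unfolding torus_product_functions_def
proof (induction rule: function_algebra.induct)
  have single: "\<exists>w\<in>character_sums n m. \<forall>t\<in>carrier (torus n). \<forall>x. \<chi> t * c x = w t x"
    if "\<chi> \<one>\<^bsub>torus n\<^esub> = 1" "c \<in> polynomial_functions m"
      "\<And>s t. s \<in> carrier (torus n) \<Longrightarrow> t \<in> carrier (torus n) \<Longrightarrow> \<chi> (s \<otimes>\<^bsub>torus n\<^esub> t) = \<chi> s * \<chi> t"
    for \<chi> c
    by (rule bexI[OF _ character_sums.summand[OF torus_character_restrict[of \<chi>, OF that(1,3)] that(2) character_sums.zero]]) auto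
  have one: "(\<lambda>_. c) \<in> polynomial_functions m" for c :: 'a
    by (simp add: polynomial_functions_def function_algebra.const)
  {
    case (const c)
    show ?case
      using single[of "\<lambda>_. 1" "\<lambda>_. c", OF _ one] by simp
  next
    case (gen f)
    then consider i where "i < n" "f = (\<lambda>(t, x). t i)" | i where "i < n" "f = (\<lambda>(t, x). inverse (t i))"
      | j where "j < m" "f = (\<lambda>(t, x). x j)"
      by auto
    then show ?case
    proof cases
      case 1
      then show ?thesis
        using single[of "\<lambda>t. t i" "\<lambda>_. 1", OF _ one] by (simp add: torus_def Gm_def)
    next
      case 2
      then show ?thesis
        using single[of "\<lambda>t. inverse (t i)" "\<lambda>_. 1", OF _ one] by (simp add: torus_def Gm_def)
    next
      case 3
      then have "(\<lambda>x. x j) \<in> polynomial_functions m"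
        by (auto simp: polynomial_functions_def intro: function_algebra.gen)
      then show ?thesis
        using single[of "\<lambda>_. 1" "\<lambda>x. x j"] 3 by simp
    qed
  next
    case (add f g)
    then obtain v w where vw: "v \<in> character_sums n m" "\<forall>t\<in>carrier (torus n). \<forall>x. f (t, x) = v t x"
      "w \<in> character_sums n m" "\<forall>t\<in>carrier (torus n). \<forall>x. g (t, x) = w t x"
      by blast
    from character_sums_add[OF vw(1,3)] vw(2,4) show ?case
      by (intro bexI[of _ "\<lambda>t x. v t x + w t x"]) auto
  next
    case (mult f g)
    then obtain v w where vw: "v \<in> character_sums n m" "\<forall>t\<in>carrier (torus n). \<forall>x. f (t, x) = v t x"
      "w \<in> character_sums n m" "\<forall>t\<in>carrier (torus n). \<forall>x. g (t, x) = w t x"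
      by blast
    from character_sums_mult[OF vw(1,3)] obtain u where
      "u \<in> character_sums n m" "\<forall>t\<in>carrier (torus n). \<forall>x. u t x = v t x * w t x"
      by blast
    with vw(2,4) show ?case
      by (intro bexI[of _ u]) auto
  }
qed

lemma character_sums_collect:
  assumes "w \<in> character_sums n m"
  shows "\<exists>C c. finite C \<and> (\<forall>\<chi>\<in>C. torus_character n \<chi>) \<and> (\<forall>\<chi>\<in>C. c \<chi> \<in> polynomial_functions m) \<and>
    (\<forall>t x. w t x = (\<Sum>\<chi>\<in>C. \<chi> t * c \<chi> x))"
  using assms
proof induction
  case zero
  show ?case
    by (intro exI[of _ "{}"]) auto
next
  case (summand \<chi> c w)
  then obtain C d where C: "finite C" "\<forall>\<chi>\<in>C. torus_character n \<chi>" "\<forall>\<chi>\<in>C. d \<chi> \<in> polynomial_functions m"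
    "\<And>t x. w t x = (\<Sum>\<chi>\<in>C. \<chi> t * d \<chi> x)"
    by blast
  define d' where "d' = d(\<chi> := (\<lambda>x. c x + (if \<chi> \<in> C then d \<chi> x else 0)))"
  have "d' \<chi> \<in> polynomial_functions m"
    using C(3) summand(2)
    by (cases "\<chi> \<in> C") (auto simp: d'_def polynomial_functions_def intro: function_algebra.add)
  moreover have "\<chi> t * c x + w t x = (\<Sum>\<psi>\<in>insert \<chi> C. \<psi> t * d' \<psi> x)" for t x
  proof -
    have "(\<Sum>\<psi>\<in>insert \<chi> C. \<psi> t * d' \<psi> x) = \<chi> t * d' \<chi> x + (\<Sum>\<psi>\<in>C - {\<chi>}. \<psi> t * d \<psi> x)"
      using C(1) by (subst sum.insert_remove) (auto simp: d'_def intro!: sum.cong)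
    also have "\<dots> = \<chi> t * c x + w t x"
      unfolding C(4) using C(1) by (auto simp: d'_def sum.remove[of C \<chi>] algebra_simps)
    finally show ?thesis ..
  qed
  ultimately show ?case
    using C summand(1) by (intro exI[of _ "insert \<chi> C"] exI[of _ d']) (auto simp: d'_def)
qed

text \<open>Dedekind's argument: subtract \<open>\<psi> s\<close> times the relation at
  \<open>t\<close> from the relation at the product of \<open>s\<close> and \<open>t\<close>. The
  term of \<open>\<psi>\<close> drops out, and the induction hypothesis gives
  \<open>(\<chi> s - \<psi> s) * d \<chi> = 0\<close>, with \<open>s\<close> chosen to tell the two
  characters apart.\<close>

lemma torus_characters_independent:
  assumes "finite C" "\<And>\<chi>. \<chi> \<in> C \<Longrightarrow> torus_character n \<chi>"
    and "\<And>t. t \<in> carrier (torus n) \<Longrightarrow> (\<Sum>\<chi>\<in>C. \<chi> t * d \<chi>) = 0"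
  shows "\<forall>\<chi>\<in>C. d \<chi> = 0"
  using assms
proof (induction C arbitrary: d rule: finite_induct)
  case empty
  then show ?case
    by simp
next
  case (insert \<psi> C)
  interpret T: group "torus n :: (nat \<Rightarrow> 'a) monoid"
    by (rule group_torus)
  have C: "d \<chi> = 0" if \<chi>: "\<chi> \<in> C" for \<chi>
  proof -
    have "\<exists>s\<in>carrier (torus n). \<chi> s \<noteq> \<psi> s"
    proof (rule ccontr)
      assume "\<not> ?thesis"
      then have "\<chi> = \<psi>"
        using insert.prems(1)[of \<chi>] insert.prems(1)[of \<psi>] \<chi>
        by (intro extensionalityI[of _ "carrier (torus n)"]) (auto simp: torus_character_def)
      with insert.hyps \<chi> show False
        by simp
    qed
    then obtain s where s: "s \<in> carrier (torus n)" "\<chi> s \<noteq> \<psi> s"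
      by blast
    have "(\<Sum>\<chi>\<in>C. \<chi> t * ((\<chi> s - \<psi> s) * d \<chi>)) = 0" if t: "t \<in> carrier (torus n)" for t
    proof -
      have mult: "\<chi> (s \<otimes>\<^bsub>torus n\<^esub> t) = \<chi> s * \<chi> t" if "\<chi> \<in> insert \<psi> C" for \<chi>
        using insert.prems(1)[OF that] s(1) t by (simp add: torus_character_def)
      have "(\<Sum>\<chi>\<in>insert \<psi> C. \<chi> t * ((\<chi> s - \<psi> s) * d \<chi>)) =
          (\<Sum>\<chi>\<in>insert \<psi> C. \<chi> (s \<otimes>\<^bsub>torus n\<^esub> t) * d \<chi>) - \<psi> s * (\<Sum>\<chi>\<in>insert \<psi> C. \<chi> t * d \<chi>)"
        unfolding sum_distrib_left sum_subtractf[symmetric]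
        by (intro sum.cong) (simp_all only: mult, simp_all add: algebra_simps)
      also have "\<dots> = 0"
        using insert.prems(2) s(1) t by simp
      finally show ?thesis
        using insert.hyps by simp
    qed
    then have "\<forall>\<chi>\<in>C. (\<chi> s - \<psi> s) * d \<chi> = 0"
      using insert.prems(1) by (intro insert.IH) auto
    with s(2) \<chi> show ?thesis
      by auto
  qed
  moreover have "d \<psi> = 0"
    using insert.prems(2)[OF T.one_closed] insert.prems(1)[of \<psi>] insert.hyps C
    by (simp add: torus_character_def)
  ultimately show ?case
    by simp
qed

section \<open>Semi-invariants of a toric variety\<close>

lemma coeff_pcompose_scale:
  fixes p :: "'a::comm_semiring_1 poly"
  shows "coeff (pcompose p [:0, c:]) k = c ^ k * coeff p k"
proof (induction p arbitrary: k)
  case (pCons a p)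
  then show ?case
    by (cases k) (auto simp: pcompose_pCons coeff_pCons mult_ac)
qed simp

text \<open>For fixed \<open>z\<close> in \<open>S\<close> the hypothesis is an identity of
  polynomials in \<open>w\<close>. Comparing leading coefficients gives the claim on
  \<open>S\<close>, and infinitely many \<open>z\<close> suffice.\<close>

lemma multiplicative_poly:
  fixes p :: "'a::{field_char_0} poly"
  assumes "infinite S" "p \<noteq> 0" "\<And>z w. z \<in> S \<Longrightarrow> poly p (z * w) = poly p z * poly p w"
  shows "poly p z = z ^ degree p"
proof -
  have "p = monom 1 (degree p)"
  proof (rule ccontr)
    assume "p \<noteq> monom 1 (degree p)"
    then have "finite {z. poly (p - monom 1 (degree p)) z = 0}"
      by (intro poly_roots_finite) auto
    moreover have "S \<subseteq> {z. poly (p - monom 1 (degree p)) z = 0}"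
    proof safe
      fix z assume z: "z \<in> S"
      have "pcompose p [:0, z:] = smult (poly p z) p"
        unfolding poly_eq_poly_eq_iff[symmetric] using assms(3)[OF z]
        by (auto simp: poly_pcompose mult.commute)
      then have "z ^ degree p * lead_coeff p = poly p z * lead_coeff p"
        by (metis coeff_pcompose_scale coeff_smult)
      then show "poly (p - monom 1 (degree p)) z = 0"
        using assms(2) by (simp add: poly_monom)
    qed
    ultimately show False
      using assms(1) finite_subset by blast
  qed
  then show ?thesis
    by (metis poly_monom mult_1)
qed

locale toric =
  fixes n m :: nat and X :: "(nat \<Rightarrow> 'k::field_char_0) set"
    and \<tau> :: "(nat \<Rightarrow> 'k) \<Rightarrow> (nat \<Rightarrow> 'k) \<Rightarrow> (nat \<Rightarrow> 'k)" and x0 :: "nat \<Rightarrow> 'k"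
  assumes variety: "affine_variety m X"
    and action: "group_action (torus n) X \<tau>"
    and regular: "regular_map (torus_product_functions n m) (carrier (torus n) \<times> X) m (\<lambda>(t, x). \<tau> t x)"
    and x0_in: "x0 \<in> X"
    and open_orbit: "zariski_closed m (X - orbit (torus n) \<tau> x0)"
begin

abbreviation T :: "(nat \<Rightarrow> 'k) set" where "T \<equiv> carrier (torus n)"
abbreviation P :: "((nat \<Rightarrow> 'k) \<Rightarrow> 'k) set" where "P \<equiv> polynomial_functions m"

sublocale function_domain X P
  by (rule function_domain_affine_variety[OF variety])

sublocale T: group "torus n :: (nat \<Rightarrow> 'k) monoid"
  by (rule group_torus)

lemma \<tau>_in: "t \<in> T \<Longrightarrow> x \<in> X \<Longrightarrow> \<tau> t x \<in> X"
  using group_action.element_image[OF action] by blast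

lemma \<tau>_one: "x \<in> X \<Longrightarrow> \<tau> \<one>\<^bsub>torus n\<^esub> x = x"
  using group_action.id_eq_one[OF action] by (metis restrict_apply')

lemma \<tau>_mult: "s \<in> T \<Longrightarrow> t \<in> T \<Longrightarrow> x \<in> X \<Longrightarrow> \<tau> (s \<otimes>\<^bsub>torus n\<^esub> t) x = \<tau> s (\<tau> t x)"
  using group_action.composition_rule[OF action] by blast

text \<open>The complement of the orbit is a zero set, and one of its equations does not vanish at
  \<open>x0\<close>.\<close>

lemma orbit_function:
  obtains g where "g \<in> P" "g x0 \<noteq> 0" "\<And>x. x \<in> X \<Longrightarrow> g x \<noteq> 0 \<Longrightarrow> \<exists>t\<in>T. x = \<tau> t x0"
proof -
  obtain F where F: "F \<subseteq> P" "X - orbit (torus n) \<tau> x0 = {x \<in> affine_space m. \<forall>f\<in>F. f x = 0}"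
    using open_orbit unfolding zariski_closed_def by blast
  have "x0 \<in> orbit (torus n) \<tau> x0"
    unfolding orbit_def using T.one_closed \<tau>_one[OF x0_in] by force
  then obtain g where g: "g \<in> F" "g x0 \<noteq> 0"
    using F(2) x0_in affine_variety_subset[OF variety] by blast
  have "\<exists>t\<in>T. x = \<tau> t x0" if "x \<in> X" "g x \<noteq> 0" for x
    using F(2) that g(1) unfolding orbit_def by blast
  with g F(1) that show thesis
    by blast
qed

lemma generic_orbit: "\<forall>\<^sub>F x in generic. \<exists>t\<in>T. x = \<tau> t x0"
proof -
  obtain g where g: "g \<in> P" "g x0 \<noteq> 0" "\<And>x. x \<in> X \<Longrightarrow> g x \<noteq> 0 \<Longrightarrow> \<exists>t\<in>T. x = \<tau> t x0"
    using orbit_function by blast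
  show ?thesis
    using generic_nonzero[OF g(1) x0_in g(2)] generic_in by eventually_elim (use g(3) in blast)
qed

lemma zero_if_zero_on_orbit:
  assumes "f \<in> P" "\<And>t. t \<in> T \<Longrightarrow> f (\<tau> t x0) = 0" "x \<in> X"
  shows "f x = 0"
  by (rule generic_zero[OF assms(1) _ assms(3)])
    (use generic_orbit in \<open>eventually_elim, use assms(2) in blast\<close>)

definition semi_invariant :: "((nat \<Rightarrow> 'k) \<Rightarrow> 'k) \<Rightarrow> ((nat \<Rightarrow> 'k) \<Rightarrow> 'k) \<Rightarrow> bool" where
  "semi_invariant \<chi> f \<longleftrightarrow> f \<in> P \<and> (\<forall>t\<in>T. \<forall>x\<in>X. f (\<tau> t x) = \<chi> t * f x)"

text \<open>A semi-invariant that vanishes at \<open>x0\<close> vanishes on the dense orbit, so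
  these are the semi-invariants that are not identically zero on \<open>X\<close>.\<close>

definition D :: "((nat \<Rightarrow> 'k) \<Rightarrow> 'k) set" where
  "D = {f. f x0 \<noteq> 0 \<and> (\<exists>\<chi>. semi_invariant \<chi> f)}"

lemma semi_invariantD: "semi_invariant \<chi> f \<Longrightarrow> t \<in> T \<Longrightarrow> x \<in> X \<Longrightarrow> f (\<tau> t x) = \<chi> t * f x"
  by (simp add: semi_invariant_def)

lemma semi_invariant_zero:
  assumes "semi_invariant \<chi> f" "f x0 = 0" "x \<in> X"
  shows "f x = 0"
  by (rule zero_if_zero_on_orbit[OF _ _ assms(3)])
    (use assms(1,2) x0_in in \<open>auto simp: semi_invariant_def\<close>)

lemma const_D: "c \<noteq> 0 \<Longrightarrow> (\<lambda>_. c) \<in> D"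
  by (auto simp: D_def semi_invariant_def const_P intro!: exI[of _ "\<lambda>_. 1"])

lemma D_mult:
  assumes "f \<in> D" "g \<in> D"
  shows "(\<lambda>x. f x * g x) \<in> D"
proof -
  obtain \<chi> \<psi> where "semi_invariant \<chi> f" "semi_invariant \<psi> g" "f x0 \<noteq> 0" "g x0 \<noteq> 0"
    using assms by (auto simp: D_def)
  then show ?thesis
    unfolding D_def semi_invariant_def
    by (auto intro!: mult_P exI[of _ "\<lambda>t. \<chi> t * \<psi> t"])
qed

lemma torus_expansion:
  assumes "f \<in> P"
  obtains C c where "finite C" "\<And>\<chi>. \<chi> \<in> C \<Longrightarrow> torus_character n \<chi>" "\<And>\<chi>. \<chi> \<in> C \<Longrightarrow> c \<chi> \<in> P"
    "\<And>t x. t \<in> T \<Longrightarrow> x \<in> X \<Longrightarrow> f (\<tau> t x) = (\<Sum>\<chi>\<in>C. \<chi> t * c \<chi> x)"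
proof -
  obtain p where p: "p \<in> torus_product_functions n m" "\<forall>y\<in>T \<times> X. f ((\<lambda>(t, x). \<tau> t x) y) = p y"
    using regular_map_comp[OF regular[unfolded torus_product_functions_def] assms]
    by (auto simp: torus_product_functions_def)
  obtain w where w: "w \<in> character_sums n m" "\<forall>t\<in>T. \<forall>x. p (t, x) = w t x"
    using torus_product_expansion[OF p(1)] by blast
  from character_sums_collect[OF w(1)] obtain C c where
    "finite C" "\<forall>\<chi>\<in>C. torus_character n \<chi>" "\<forall>\<chi>\<in>C. c \<chi> \<in> P" "\<forall>t x. w t x = (\<Sum>\<chi>\<in>C. \<chi> t * c \<chi> x)"
    by blast
  with p(2) w(2) show thesis
    by (intro that[of C c]) auto
qed

lemma \<tau>_regular:
  assumes "t \<in> T" "f \<in> P"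
  obtains f' where "f' \<in> P" "\<And>x. x \<in> X \<Longrightarrow> f (\<tau> t x) = f' x"
proof -
  obtain C c where "finite C" "\<And>\<chi>. \<chi> \<in> C \<Longrightarrow> torus_character n \<chi>" "\<And>\<chi>. \<chi> \<in> C \<Longrightarrow> c \<chi> \<in> P"
    "\<And>t x. t \<in> T \<Longrightarrow> x \<in> X \<Longrightarrow> f (\<tau> t x) = (\<Sum>\<chi>\<in>C. \<chi> t * c \<chi> x)"
    using torus_expansion[OF assms(2)] by blast
  with assms(1) show thesis
    by (intro that[of "\<lambda>x. \<Sum>\<chi>\<in>C. \<chi> t * c \<chi> x"] sum_P mult_P const_P) auto
qed

text \<open>At the identity of the torus, the torus expansion of a coordinate function is a sum of
  coefficient functions; independence of characters makes these semi-invariant. Those outside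
  \<open>D\<close> are zero on \<open>X\<close>.\<close>

lemma D_separating:
  assumes "x \<in> X" "y \<in> X" "\<And>f. f \<in> D \<Longrightarrow> f x = f y"
  shows "x = y"
proof (rule extensionalityI[of _ "{..<m}"])
  show "x \<in> extensional {..<m}" "y \<in> extensional {..<m}"
    using affine_variety_subset[OF variety] assms(1,2) by (auto simp: affine_space_def PiE_def)
  fix j assume j: "j \<in> {..<m}"
  have "(\<lambda>x. x j) \<in> P"
    using j by (auto simp: polynomial_functions_def intro: function_algebra.gen)
  from torus_expansion[OF this] obtain C c where C: "finite C" "\<And>\<chi>. \<chi> \<in> C \<Longrightarrow> torus_character n \<chi>" "\<And>\<chi>. \<chi> \<in> C \<Longrightarrow> c \<chi> \<in> P"
    "\<And>t x. t \<in> T \<Longrightarrow> x \<in> X \<Longrightarrow> (\<tau> t x) j = (\<Sum>\<chi>\<in>C. \<chi> t * c \<chi> x)"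
    by blast
  have "semi_invariant \<chi> (c \<chi>)" if \<chi>: "\<chi> \<in> C" for \<chi>
    unfolding semi_invariant_def
  proof (intro conjI ballI)
    show "c \<chi> \<in> P"
      using C(3) \<chi> .
    fix s z assume s: "s \<in> T" and z: "z \<in> X"
    \<comment> \<open>The coordinate of \<open>\<tau> t (\<tau> s z)\<close> is expanded once at
      \<open>\<tau> s z\<close> and once at \<open>z\<close>.\<close>
    have "(\<Sum>\<chi>\<in>C. \<chi> t * (c \<chi> (\<tau> s z) - \<chi> s * c \<chi> z)) = 0" if t: "t \<in> T" for t
    proof -
      have "(\<Sum>\<chi>\<in>C. \<chi> t * c \<chi> (\<tau> s z)) = (\<Sum>\<chi>\<in>C. \<chi> (t \<otimes>\<^bsub>torus n\<^esub> s) * c \<chi> z)"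
        using C(4)[OF t \<tau>_in[OF s z]] C(4)[OF T.m_closed[OF t s] z] \<tau>_mult[OF t s z] by simp
      also have "\<dots> = (\<Sum>\<chi>\<in>C. \<chi> t * (\<chi> s * c \<chi> z))"
        using C(2) s t by (intro sum.cong) (auto simp: torus_character_def)
      finally show ?thesis
        by (simp add: right_diff_distrib sum_subtractf)
    qed
    from torus_characters_independent[OF C(1,2) this] \<chi>
    show "c \<chi> (\<tau> s z) = \<chi> s * c \<chi> z"
      by auto
  qed
  then have "c \<chi> x = c \<chi> y" if "\<chi> \<in> C" for \<chi>
    using assms semi_invariant_zero[of \<chi> "c \<chi>"] that
    by (cases "c \<chi> x0 = 0") (auto simp: D_def)
  then show "x j = y j"
    using C(4)[OF T.one_closed assms(1)] C(4)[OF T.one_closed assms(2)] \<tau>_one assms(1,2) by simp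
qed

end

section \<open>Normalized actions of the additive group\<close>

text \<open>In the expansion of \<open>p\<close> in powers of \<open>a + b\<close>, only the power
  \<open>Suc M\<close> contributes to degree \<open>Suc M\<close>, and only the powers
  \<open>M\<close> and \<open>Suc M\<close> to degree \<open>M\<close>.\<close>

lemma coeff_translate:
  fixes p q :: "'a::field_char_0 poly"
  assumes "degree p \<le> Suc M" "\<And>a. poly q a = poly p (a + b)"
  shows "coeff q (Suc M) = coeff p (Suc M)"
    and "coeff q M = coeff p M + of_nat (Suc M) * b * coeff p (Suc M)"
proof -
  have "poly q a = poly (\<Sum>i\<le>Suc M. smult (coeff p i) ([:b, 1:] ^ i)) a" for a
  proof -
    have "poly p (a + b) = poly (\<Sum>i\<le>Suc M. monom (coeff p i) i) (a + b)"
      by (simp only: poly_as_sum_of_monoms'[OF assms(1)])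
    then show ?thesis
      by (simp add: assms(2) poly_sum poly_monom add.commute del: sum.atMost_Suc)
  qed
  then have q: "q = (\<Sum>i\<le>Suc M. smult (coeff p i) ([:b, 1:] ^ i))"
    by (simp only: poly_eq_poly_eq_iff[symmetric] fun_eq_iff simp_thms)
  have low: "coeff ([:b, 1:] ^ i) j = 0" if "i < j" for i j
    using that by (intro coeff_eq_0) (simp add: degree_linear_power)
  show "coeff q (Suc M) = coeff p (Suc M)"
    unfolding q by (simp add: coeff_sum low coeff_linear_poly_power)
  have "{..M} = insert M {..<M}"
    by auto
  then have "(\<Sum>i\<le>M. coeff p i * coeff ([:b, 1:] ^ i) M) = coeff p M"
    by (simp add: low coeff_linear_poly_power)
  moreover have "coeff ([:b, 1:] ^ Suc M) M = of_nat (Suc M) * b"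
    using coeff_linear_poly_power[of M "Suc M" b 1] by simp
  ultimately show "coeff q M = coeff p M + of_nat (Suc M) * b * coeff p (Suc M)"
    unfolding q by (simp add: coeff_sum del: power_Suc)
qed

locale toric_group = toric +
  fixes K :: "((nat \<Rightarrow> 'a) \<Rightarrow> (nat \<Rightarrow> 'a)) set"
  assumes K_subgroup: "subgroup K (BijGroup X)"
    and K_aut: "K \<subseteq> carrier (aut_group m X)"
begin

sublocale semi_invariants X P K D x0
proof (rule semi_invariants.intro[OF function_domain_axioms semi_invariants_axioms.intro[OF K_subgroup]])
  show "\<exists>p'\<in>P. \<forall>x\<in>X. p (g x) = p' x" if "g \<in> K" "p \<in> P" for g p
  proof -
    have "regular_map (function_algebra ((\<lambda>j x. x j) ` {..<m})) X m g"
      using that(1) K_aut by (auto simp: aut_group_def polynomial_functions_def)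
    from regular_map_comp[OF this that(2)] show ?thesis
      by (simp add: polynomial_functions_def)
  qed
  show "D \<subseteq> P"
    by (auto simp: D_def semi_invariant_def)
  show "(\<lambda>_. 1) \<in> D"
    by (rule const_D) simp
  show "f x0 \<noteq> 0" if "f \<in> D" for f
    using that by (simp add: D_def)
qed (fact D_mult x0_in D_separating)+

end

text \<open>\<open>normalizes\<close> lets \<open>b\<close> depend on \<open>t\<close> and
  \<open>a\<close> in any way; that it is a scalar multiple of \<open>a\<close> is derived in
  \<open>conjugation_scalar\<close>.\<close>

locale normalized_Ga = toric_group +
  fixes \<phi> :: "'a \<Rightarrow> (nat \<Rightarrow> 'a) \<Rightarrow> (nat \<Rightarrow> 'a)"
  assumes \<phi>_action: "faithful_action Ga X \<phi>"
    and \<phi>_regular: "regular_map (Ga_product_functions m) (UNIV \<times> X) m (\<lambda>(a, x). \<phi> a x)"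
    and normalizes: "\<And>t a. t \<in> T \<Longrightarrow> \<exists>b. \<forall>x\<in>X. \<tau> t (\<phi> a x) = \<phi> b (\<tau> t x)"
    and \<phi>_K: "\<And>a. \<phi> a \<in> K"
begin

lemma \<phi>_in: "x \<in> X \<Longrightarrow> \<phi> a x \<in> X"
  using K_in \<phi>_K by blast

lemma \<phi>_group_action: "group_action Ga X \<phi>"
  using \<phi>_action by (rule faithful_action.axioms)

lemma \<phi>_add: "x \<in> X \<Longrightarrow> \<phi> (a + b) x = \<phi> a (\<phi> b x)"
  using group_action.composition_rule[OF \<phi>_group_action, of x a b] by (simp add: Ga_def)

lemma \<phi>_zero: "x \<in> X \<Longrightarrow> \<phi> 0 x = x"
  using fun_cong[OF group_action.id_eq_one[OF \<phi>_group_action], of x] by (simp add: Ga_def)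

lemma \<phi>_inj:
  assumes "\<And>x. x \<in> X \<Longrightarrow> \<phi> a x = \<phi> b x"
  shows "a = b"
proof -
  have "\<phi> a = \<phi> b"
    using assms Bij_imp_extensional[OF K_Bij[OF \<phi>_K]] by (metis extensionalityI)
  then show ?thesis
    using faithful_action.faithful[OF \<phi>_action] by (auto simp: Ga_def inj_on_def)
qed

text \<open>On \<open>X\<close> the coefficient of degree \<open>k\<close> is
  \<open>\<partial>^k f / k!\<close> for the locally nilpotent derivation that generates the
  action.\<close>

definition expands :: "((nat \<Rightarrow> 'a) \<Rightarrow> 'a) \<Rightarrow> ((nat \<Rightarrow> 'a) \<Rightarrow> 'a poly) \<Rightarrow> nat \<Rightarrow> bool" where
  "expands f r N \<longleftrightarrow> (\<forall>k. (\<lambda>x. coeff (r x) k) \<in> P) \<and> (\<forall>x. degree (r x) \<le> N) \<and>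
    (\<forall>a. \<forall>x\<in>X. f (\<phi> a x) = poly (r x) a)"

lemma expandsD:
  assumes "expands f r N"
  shows "(\<lambda>x. coeff (r x) k) \<in> P" "degree (r x) \<le> N" "x \<in> X \<Longrightarrow> f (\<phi> a x) = poly (r x) a"
  using assms by (auto simp: expands_def)

lemma expansion:
  assumes "f \<in> P"
  obtains r N where "expands f r N"
proof -
  obtain p where p: "p \<in> Ga_product_functions m" "\<forall>y\<in>UNIV \<times> X. f ((\<lambda>(a, x). \<phi> a x) y) = p y"
    using regular_map_comp[OF \<phi>_regular[unfolded Ga_product_functions_def] assms]
    by (auto simp: Ga_product_functions_def)
  from Ga_product_expansion[OF p(1)] obtain r N where r:
    "\<forall>k. (\<lambda>x. coeff (r x) k) \<in> P" "\<forall>x. degree (r x) \<le> N" "\<forall>a x. p (a, x) = poly (r x) a"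
    by blast
  have "f (\<phi> a x) = poly (r x) a" if "x \<in> X" for a x
    using bspec[OF p(2), of "(a, x)"] r(3) that by simp
  with r(1,2) that[of r N] show thesis
    unfolding expands_def by blast
qed

text \<open>Along an orbit the top coefficient is invariant and the one below it moves linearly: a
  local slice. A positive degree occurs because \<open>\<phi> 1\<close> changes the value of
  \<open>f\<close> at \<open>y\<close>.\<close>

lemma slice:
  assumes r: "expands f r N0" and y: "y \<in> X" "f (\<phi> 1 y) \<noteq> f y"
  obtains M where "\<exists>x\<in>X. coeff (r x) (Suc M) \<noteq> 0"
    "\<And>b x. x \<in> X \<Longrightarrow> coeff (r (\<phi> b x)) (Suc M) = coeff (r x) (Suc M)"
    "\<And>b x. x \<in> X \<Longrightarrow> coeff (r (\<phi> b x)) M = coeff (r x) M + of_nat (Suc M) * b * coeff (r x) (Suc M)"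
proof -
  \<comment> \<open>The degrees that occur somewhere on \<open>X\<close>; the maximum of this set
    becomes \<open>Suc M\<close>.\<close>
  define A where "A = {k. \<exists>x\<in>X. coeff (r x) k \<noteq> 0}"
  have fin: "finite A"
    by (rule finite_subset[of _ "{..N0}"]) (auto simp: A_def dest!: le_degree intro: order_trans expandsD(2)[OF r])
  have "\<exists>k\<in>A. k > 0"
  proof (rule ccontr)
    assume neg: "\<not> ?thesis"
    then have "coeff (r y) k = 0" if "k > 0" for k
      using y(1) that by (auto simp: A_def)
    then have "r y = [:coeff (r y) 0:]"
      by (intro poly_eqI) (simp add: coeff_pCons split: nat.split)
    then have "f (\<phi> 1 y) = f (\<phi> 0 y)"
      using expandsD(3)[OF r y(1)] by (metis poly_pCons poly_0 mult_zero_right)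
    with y \<phi>_zero show False
      by simp
  qed
  then obtain k where k: "k \<in> A" "k > 0"
    by blast
  then have "Max A \<ge> k" "Max A \<in> A"
    using fin Max_in[OF fin] by (blast intro: Max_ge)+
  with k obtain M where M: "Max A = Suc M"
    by (cases "Max A") auto
  have deg: "degree (r x) \<le> Suc M" if "x \<in> X" for x
  proof (cases "r x = 0")
    case False
    then have "degree (r x) \<in> A"
      using that leading_coeff_neq_0[OF False] unfolding A_def by blast
    with fin M show ?thesis
      using Max_ge by metis
  qed simp
  have "poly (r (\<phi> b x)) a = poly (r x) (a + b)" if "x \<in> X" for a b x
    using expandsD(3)[OF r \<phi>_in[OF that], of a b] expandsD(3)[OF r that, of "a + b"] \<phi>_add[OF that] by simp
  with deg have "coeff (r (\<phi> b x)) (Suc M) = coeff (r x) (Suc M)"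
    "coeff (r (\<phi> b x)) M = coeff (r x) M + of_nat (Suc M) * b * coeff (r x) (Suc M)" if "x \<in> X" for b x
    using coeff_translate[of "r x" M "r (\<phi> b x)" b] that by blast+
  moreover have "\<exists>x\<in>X. coeff (r x) (Suc M) \<noteq> 0"
    using \<open>Max A \<in> A\<close> M by (simp add: A_def)
  ultimately show thesis
    using that by blast
qed

lemma \<phi>_nontrivial:
  obtains f y where "f \<in> D" "y \<in> X" "f (\<phi> 1 y) \<noteq> f y"
proof -
  have "\<exists>y\<in>X. \<phi> 1 y \<noteq> y"
    using \<phi>_inj[of 1 0] \<phi>_zero by fastforce
  then obtain y where "y \<in> X" "\<phi> 1 y \<noteq> y"
    by blast
  with D_separates[of "\<phi> 1 y" y] \<phi>_in that show thesis
    by blast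
qed

lemma \<tau>_inverse:
  assumes "t \<in> T" "x \<in> X"
  shows "\<tau> (inv\<^bsub>torus n\<^esub> t) (\<tau> t x) = x" "\<tau> t (\<tau> (inv\<^bsub>torus n\<^esub> t) x) = x"
  unfolding \<tau>_mult[symmetric, OF T.inv_closed[OF assms(1)] assms] \<tau>_mult[symmetric, OF assms(1) T.inv_closed[OF assms(1)] assms(2)]
    T.l_inv[OF assms(1)] T.r_inv[OF assms(1)]
  by (rule \<tau>_one[OF assms(2)])+

text \<open>An additive polynomial map is linear in characteristic zero; hence \<open>T\<close> acts on the
  additive group by scalars.\<close>

lemma conjugation_scalar:
  assumes t: "t \<in> T"
  shows "\<exists>c. c \<noteq> 0 \<and> (\<forall>a. \<forall>x\<in>X. \<tau> t (\<phi> a x) = \<phi> (c * a) (\<tau> t x))"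
proof -
  have t': "inv\<^bsub>torus n\<^esub> t \<in> T"
    using t by (rule T.inv_closed)
  from normalizes[OF t] obtain \<alpha> where \<alpha>: "\<And>a x. x \<in> X \<Longrightarrow> \<tau> t (\<phi> a x) = \<phi> (\<alpha> a) (\<tau> t x)"
    by metis
  have add: "\<alpha> (a + b) = \<alpha> a + \<alpha> b" for a b
  proof (rule \<phi>_inj)
    fix x assume x: "x \<in> X"
    let ?y = "\<tau> (inv\<^bsub>torus n\<^esub> t) x"
    have y: "?y \<in> X" "\<tau> t ?y = x"
      using \<tau>_in[OF t' x] \<tau>_inverse(2)[OF t x] by auto
    have "\<phi> (\<alpha> (a + b)) x = \<tau> t (\<phi> a (\<phi> b ?y))"
      using \<alpha>[OF y(1), of "a + b"] y \<phi>_add by simp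
    also have "\<dots> = \<phi> (\<alpha> a + \<alpha> b) x"
      using \<alpha>[OF \<phi>_in[OF y(1)]] \<alpha>[OF y(1)] y(2) \<phi>_add[OF x] by simp
    finally show "\<phi> (\<alpha> (a + b)) x = \<phi> (\<alpha> a + \<alpha> b) x" .
  qed
  obtain f y where f: "f \<in> D" "y \<in> X" "f (\<phi> 1 y) \<noteq> f y"
    using \<phi>_nontrivial by blast
  obtain r N0 where r: "expands f r N0"
    using expansion[OF D_P[OF f(1)]] by blast
  obtain M z where z: "z \<in> X" "coeff (r z) (Suc M) \<noteq> 0"
    and sl: "\<And>b. coeff (r (\<phi> b z)) M = coeff (r z) M + of_nat (Suc M) * b * coeff (r z) (Suc M)"
    using slice[OF r f(2,3)] by metis
  \<comment> \<open>The slice \<open>?h\<close> is affine along the orbit of \<open>z\<close>, so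
    \<open>\<alpha> a\<close> can be solved for; the result \<open>S\<close> is a polynomial in
    \<open>a\<close>.\<close>
  let ?h = "\<lambda>x. coeff (r x) M" and ?z = "\<tau> (inv\<^bsub>torus n\<^esub> t) z"
  have z': "?z \<in> X" "\<tau> t ?z = z"
    using \<tau>_in[OF t' z(1)] \<tau>_inverse(2)[OF t z(1)] by auto
  obtain h' where h': "h' \<in> P" "\<And>x. x \<in> X \<Longrightarrow> ?h (\<tau> t x) = h' x"
    using \<tau>_regular[OF t expandsD(1)[OF r, of M]] by blast
  obtain s N1 where s: "expands h' s N1"
    using expansion[OF h'(1)] by blast
  define e where "e = of_nat (Suc M) * coeff (r z) (Suc M)"
  define S where "S = smult (1 / e) (s ?z - [:?h z:])"
  have e: "e \<noteq> 0"
    using z(2) by (simp add: e_def del: of_nat_Suc)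
  have S: "\<alpha> a = poly S a" for a
  proof -
    have "poly (s ?z) a = ?h (\<tau> t (\<phi> a ?z))"
      using expandsD(3)[OF s z'(1)] h'(2)[OF \<phi>_in[OF z'(1)]] by simp
    also have "\<dots> = ?h z + \<alpha> a * e"
      using \<alpha>[OF z'(1), of a] z'(2) sl[of "\<alpha> a"] by (simp add: e_def mult_ac)
    finally show ?thesis
      using e by (simp add: S_def)
  qed
  have nat: "\<alpha> (of_nat k) = of_nat k * \<alpha> 1" for k
  proof (induction k)
    case 0
    then show ?case
      using add[of 0 0] by simp
  next
    case (Suc k)
    then show ?case
      using add[of 1 "of_nat k"] by (simp add: algebra_simps)
  qed
  \<comment> \<open>Additivity makes \<open>\<alpha>\<close> linear on the natural numbers, and
    these are infinitely many points.\<close>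
  have lin: "S = [:0, \<alpha> 1:]"
  proof (rule ccontr)
    assume "S \<noteq> [:0, \<alpha> 1:]"
    then have "finite {a. poly (S - [:0, \<alpha> 1:]) a = 0}"
      by (intro poly_roots_finite) auto
    moreover have "range of_nat \<subseteq> {a. poly (S - [:0, \<alpha> 1:]) a = 0}"
      using nat S by auto
    ultimately show False
      using finite_subset infinite_UNIV_char_0 finite_imageD[of of_nat UNIV] by (metis inj_of_nat infinite_UNIV_nat)
  qed
  have \<alpha>_lin: "\<alpha> a = \<alpha> 1 * a" for a
    using S[of a] by (subst (asm) lin) (simp add: mult.commute)
  have "\<alpha> 1 \<noteq> 0"
  proof
    assume "\<alpha> 1 = 0"
    have "\<phi> 1 x = \<phi> 0 x" if x: "x \<in> X" for x
    proof -
      have "\<tau> t (\<phi> 1 x) = \<tau> t x"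
        using \<alpha>[OF x, of 1] \<open>\<alpha> 1 = 0\<close> \<phi>_zero[OF \<tau>_in[OF t x]] by simp
      then show ?thesis
        using \<tau>_inverse(1)[OF t] x \<phi>_in \<phi>_zero by metis
    qed
    then show False
      using \<phi>_inj[of 1 0] by simp
  qed
  with \<alpha> \<alpha>_lin show ?thesis
    by metis
qed

text \<open>This is the inverse of the character of the root: in \<open>equivariant_slice\<close>
  the quotient \<open>q / h\<close> scales by \<open>1 / weight t\<close>.\<close>

definition weight :: "(nat \<Rightarrow> 'a) \<Rightarrow> 'a" where
  "weight t = (SOME c. c \<noteq> 0 \<and> (\<forall>a. \<forall>x\<in>X. \<tau> t (\<phi> a x) = \<phi> (c * a) (\<tau> t x)))"

lemma
  assumes "t \<in> T"
  shows weight_nonzero: "weight t \<noteq> 0"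
    and \<tau>_\<phi>: "x \<in> X \<Longrightarrow> \<tau> t (\<phi> a x) = \<phi> (weight t * a) (\<tau> t x)"
  using someI_ex[OF conjugation_scalar[OF assms]] unfolding weight_def by blast+

text \<open>Conjugation by the torus rescales the parameter by \<open>weight t\<close>; compare
  coefficients of the resulting polynomial identity in \<open>a\<close>.\<close>

lemma coeff_semi_invariant:
  assumes "semi_invariant \<chi> f" "expands f r N"
  shows "semi_invariant (\<lambda>t. \<chi> t / weight t ^ k) (\<lambda>x. coeff (r x) k)"
  unfolding semi_invariant_def
proof (intro conjI ballI)
  show "(\<lambda>x. coeff (r x) k) \<in> P"
    by (rule expandsD(1)[OF assms(2)])
  fix t x assume t: "t \<in> T" and x: "x \<in> X"
  have "poly (r (\<tau> t x)) (weight t * a) = \<chi> t * poly (r x) a" for a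
    using expandsD(3)[OF assms(2) \<tau>_in[OF t x], of "weight t * a"] \<tau>_\<phi>[OF t x, of a]
      semi_invariantD[OF assms(1) t \<phi>_in[OF x], of a] expandsD(3)[OF assms(2) x, of a] by simp
  then have "pcompose (r (\<tau> t x)) [:0, weight t:] = smult (\<chi> t) (r x)"
    by (simp add: poly_eq_poly_eq_iff[symmetric] fun_eq_iff poly_pcompose mult.commute)
  then have "weight t ^ k * coeff (r (\<tau> t x)) k = \<chi> t * coeff (r x) k"
    by (metis coeff_pcompose_scale coeff_smult)
  then show "coeff (r (\<tau> t x)) k = \<chi> t / weight t ^ k * coeff (r x) k"
    using weight_nonzero[OF t] by (simp add: field_simps)
qed

lemma D_nonzero_orbit: "semi_invariant \<chi> f \<Longrightarrow> f x0 \<noteq> 0 \<Longrightarrow> t \<in> T \<Longrightarrow> \<chi> t \<noteq> 0"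
  using semi_invariantD[of \<chi> f "inv\<^bsub>torus n\<^esub> t" "\<tau> t x0"] semi_invariantD[of \<chi> f t x0]
    \<tau>_inverse(1)[of t x0] \<tau>_in[of t x0] x0_in T.inv_closed[of t] by auto

text \<open>The two top coefficients from \<open>slice\<close>, with the factor \<open>Suc M\<close>
  moved into \<open>q\<close>. If \<open>h\<close> vanished at \<open>x0\<close> it would vanish on
  \<open>X\<close>, but then its value at \<open>\<phi> 1 x0\<close> would be
  \<open>q x0 \<noteq> 0\<close>.\<close>

lemma equivariant_slice:
  obtains h q \<chi> where "h \<in> D" "q \<in> D" "semi_invariant \<chi> h" "semi_invariant (\<lambda>t. \<chi> t / weight t) q"
    "\<And>b x. x \<in> X \<Longrightarrow> h (\<phi> b x) = h x + b * q x" "\<And>b x. x \<in> X \<Longrightarrow> q (\<phi> b x) = q x"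
proof -
  obtain f y where f: "f \<in> D" "y \<in> X" "f (\<phi> 1 y) \<noteq> f y"
    using \<phi>_nontrivial by blast
  then obtain \<chi> where \<chi>: "semi_invariant \<chi> f"
    by (auto simp: D_def)
  obtain r N0 where r: "expands f r N0"
    using expansion[OF D_P[OF f(1)]] by blast
  obtain M z where z: "z \<in> X" "coeff (r z) (Suc M) \<noteq> 0"
    and sl: "\<And>b x. x \<in> X \<Longrightarrow> coeff (r (\<phi> b x)) (Suc M) = coeff (r x) (Suc M)"
    "\<And>b x. x \<in> X \<Longrightarrow> coeff (r (\<phi> b x)) M = coeff (r x) M + of_nat (Suc M) * b * coeff (r x) (Suc M)"
    using slice[OF r f(2,3)] by metis
  define h where "h x = coeff (r x) M" for x
  define q where "q x = of_nat (Suc M) * coeff (r x) (Suc M)" for x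
  have h: "semi_invariant (\<lambda>t. \<chi> t / weight t ^ M) h"
    unfolding h_def by (rule coeff_semi_invariant[OF \<chi> r])
  have "semi_invariant (\<lambda>t. \<chi> t / weight t ^ Suc M) (\<lambda>x. coeff (r x) (Suc M))"
    by (rule coeff_semi_invariant[OF \<chi> r])
  then have q: "semi_invariant (\<lambda>t. \<chi> t / weight t ^ M / weight t) q"
    unfolding semi_invariant_def q_def by (auto simp: mult_ac intro!: mult_P const_P simp del: of_nat_Suc)
  have inv: "h (\<phi> b x) = h x + b * q x" "q (\<phi> b x) = q x" if "x \<in> X" for b x
    using sl[OF that] by (simp_all add: h_def q_def mult_ac del: of_nat_Suc)
  have "q z \<noteq> 0"
    using z(2) by (simp add: q_def del: of_nat_Suc)
  then have q0: "q x0 \<noteq> 0"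
    using semi_invariant_zero[OF q _ z(1)] by blast
  have "h x0 \<noteq> 0"
    using semi_invariant_zero[OF h _ \<phi>_in[OF x0_in]] inv(1)[OF x0_in, of 1] q0 by auto
  with q0 h q inv show thesis
    by (intro that[of h q "\<lambda>t. \<chi> t / weight t ^ M"]) (auto simp: D_def)
qed

text \<open>An equation of the boundary that is nonzero at \<open>x0\<close>, evaluated along
  \<open>\<phi> a x0\<close>, is a nonzero polynomial in \<open>a\<close>; so only finitely many
  parameters leave the open orbit.\<close>

lemma orbit_infinite: "infinite {a. \<exists>t\<in>T. \<phi> a x0 = \<tau> t x0}"
proof
  assume fin: "finite {a. \<exists>t\<in>T. \<phi> a x0 = \<tau> t x0}"
  obtain g where g: "g \<in> P" "g x0 \<noteq> 0" "\<And>x. x \<in> X \<Longrightarrow> g x \<noteq> 0 \<Longrightarrow> \<exists>t\<in>T. x = \<tau> t x0"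
    using orbit_function by blast
  obtain r N where r: "expands g r N"
    using expansion[OF g(1)] by blast
  have "poly (r x0) 0 \<noteq> 0"
    using expandsD(3)[OF r x0_in, of 0] \<phi>_zero[OF x0_in] g(2) by simp
  then have "finite {a. poly (r x0) a = 0}"
    by (intro poly_roots_finite) auto
  moreover have "UNIV \<subseteq> {a. \<exists>t\<in>T. \<phi> a x0 = \<tau> t x0} \<union> {a. poly (r x0) a = 0}"
    using g(3)[OF \<phi>_in[OF x0_in]] expandsD(3)[OF r x0_in] by auto
  ultimately show False
    using fin finite_subset[of UNIV] infinite_UNIV_char_0[where ?'a = 'a] by blast
qed

text \<open>On the open orbit the root group moves a semi-invariant by a power of \<open>1 + a \<cdot> q / h\<close>: with
  \<open>z = 1 + a \<cdot> q x0 / h x0\<close>, the point \<open>\<phi> a x0\<close> is a torus translate \<open>\<tau> t x0\<close> with \<open>weight t = z\<close>, so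
  that the value of the semi-invariant is a multiplicative polynomial in \<open>z\<close>.\<close>

lemma exists_root: "\<exists>r. is_root r \<and> grp r = \<phi>"
proof -
  obtain h q \<chi> where D: "h \<in> D" "q \<in> D"
    and h: "semi_invariant \<chi> h" and q: "semi_invariant (\<lambda>t. \<chi> t / weight t) q"
    and h_\<phi>: "\<And>b x. x \<in> X \<Longrightarrow> h (\<phi> b x) = h x + b * q x"
    and q_\<phi>: "\<And>b x. x \<in> X \<Longrightarrow> q (\<phi> b x) = q x"
    using equivariant_slice by blast
  define s where "s x = q x / h x" for x
  have nz: "h x0 \<noteq> 0" "q x0 \<noteq> 0" "s x0 \<noteq> 0"
    using D by (auto simp: D_def s_def)
  have s_orbit: "s (\<tau> t x0) = s x0 / weight t" if "t \<in> T" for t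
    using semi_invariantD[OF h that x0_in] semi_invariantD[OF q that x0_in]
      D_nonzero_orbit[OF h nz(1) that] by (simp add: s_def)
  have level: "\<exists>d. \<forall>a. f (\<phi> a x0) = f x0 * (1 + a * s x0) ^ d" if f: "f \<in> D" for f
  proof -
    obtain \<psi> where \<psi>: "semi_invariant \<psi> f" "f x0 \<noteq> 0"
      using f by (auto simp: D_def)
    obtain r N where r: "expands f r N"
      using expansion[OF D_P[OF f]] by blast
    \<comment> \<open>\<open>p\<close> is the value of \<open>f\<close> along the orbit, divided by
      \<open>f x0\<close> and written in the variable \<open>z = 1 + a * s x0\<close>.\<close>
    define p where "p = smult (1 / f x0) (pcompose (r x0) [:- 1 / s x0, 1 / s x0:])"
    have p: "f x0 * poly p z = f (\<phi> ((z - 1) / s x0) x0)" for z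
      using expandsD(3)[OF r x0_in, of "(z - 1) / s x0"] \<psi>(2)
      by (simp add: p_def poly_pcompose diff_divide_distrib)
    \<comment> \<open>The values \<open>z\<close> at which the orbit curve stays inside the open
      torus orbit.\<close>
    define S where "S = (\<lambda>a. 1 + a * s x0) ` {a. \<exists>t\<in>T. \<phi> a x0 = \<tau> t x0}"
    have "inj (\<lambda>a. 1 + a * s x0)"
      using nz(3) by (auto simp: inj_on_def)
    then have "infinite S"
      unfolding S_def using orbit_infinite finite_imageD inj_on_subset by blast
    moreover have "p \<noteq> 0"
      using p[of 1] \<phi>_zero[OF x0_in] \<psi>(2) by auto
    moreover have "poly p (z * w) = poly p z * poly p w" if "z \<in> S" for z w
    proof -
      obtain a t where a: "z = 1 + a * s x0" and t: "t \<in> T" "\<phi> a x0 = \<tau> t x0"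
        using \<open>z \<in> S\<close> by (auto simp: S_def)
      have a': "(z - 1) / s x0 = a"
        using a nz(3) by simp
      have "\<chi> t * h x0 = h x0 + a * q x0"
        using semi_invariantD[OF h t(1) x0_in] h_\<phi>[OF x0_in, of a] t(2) by simp
      then have "\<chi> t = z"
        using nz by (simp add: a s_def field_simps)
      moreover have "\<chi> t / weight t * q x0 = q x0"
        using semi_invariantD[OF q t(1) x0_in] q_\<phi>[OF x0_in, of a] t(2) by simp
      ultimately have wt: "weight t = z"
        using nz(2) weight_nonzero[OF t(1)] by (simp add: field_simps)
      \<comment> \<open>Since \<open>weight t = z\<close>, moving by
        \<open>(z * w - 1) / s x0\<close> is moving by \<open>a\<close> followed by a torus
        conjugate of moving by \<open>(w - 1) / s x0\<close>.\<close>
      have "f x0 * poly p (z * w) = f (\<phi> (z * ((w - 1) / s x0) + a) x0)"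
        unfolding p a'[symmetric] by (simp add: field_simps diff_divide_distrib)
      also have "\<dots> = f (\<tau> t (\<phi> ((w - 1) / s x0) x0))"
        using \<phi>_add[OF x0_in, of "z * ((w - 1) / s x0)" a] \<tau>_\<phi>[OF t(1) x0_in, of "(w - 1) / s x0"] t(2) wt by simp
      also have "\<dots> = \<psi> t * (f x0 * poly p w)"
        using semi_invariantD[OF \<psi>(1) t(1) \<phi>_in[OF x0_in]] p by simp
      also have "\<psi> t * f x0 = f x0 * poly p z"
        using semi_invariantD[OF \<psi>(1) t(1) x0_in] p[of z] t(2) a' by (metis)
      then have "\<psi> t * (f x0 * poly p w) = f x0 * (poly p z * poly p w)"
        by (simp add: mult.assoc[symmetric])
      finally show ?thesis
        using \<psi>(2) by simp
    qed
    ultimately have "poly p z = z ^ degree p" for z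
      by (rule multiplicative_poly)
    then have "f (\<phi> a x0) = f x0 * (1 + a * s x0) ^ degree p" for a
      using p[of "1 + a * s x0"] nz(3) by simp
    then show ?thesis
      by blast
  qed
  then obtain \<nu> where \<nu>: "\<And>f a. f \<in> D \<Longrightarrow> f (\<phi> a x0) = f x0 * (1 + a * s x0) ^ \<nu> f"
    by metis
  have \<nu>_unique: "\<nu> f = d" if f: "f \<in> D" "f (\<phi> (1 / s x0) x0) = f x0 * 2 ^ d" for f d
    using \<nu>[OF f(1), of "1 / s x0"] f nz(3) by (simp add: D_def two_power_eq_iff)
  \<comment> \<open>Transport from \<open>x0\<close> by the torus: the factor
    \<open>1 / weight t\<close> on the parameter is the one that \<open>s\<close> acquires.\<close>
  have \<nu>_orbit: "f (\<phi> a (\<tau> t x0)) = f (\<tau> t x0) * (1 + a * s (\<tau> t x0)) ^ \<nu> f"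
    if f: "f \<in> D" and t: "t \<in> T" for f a t
  proof -
    obtain \<psi> where \<psi>: "semi_invariant \<psi> f"
      using f by (auto simp: D_def)
    have "\<phi> a (\<tau> t x0) = \<tau> t (\<phi> (a / weight t) x0)"
      using \<tau>_\<phi>[OF t x0_in, of "a / weight t"] weight_nonzero[OF t] by simp
    then show ?thesis
      using semi_invariantD[OF \<psi> t \<phi>_in[OF x0_in]] semi_invariantD[OF \<psi> t x0_in] \<nu>[OF f] s_orbit[OF t]
      by simp
  qed
  define R where "R = Root \<phi> \<nu> h q"
  have slope_R: "slope R = s"
    by (auto simp: slope_def s_def R_def)
  have "acts \<nu> (\<lambda>x. a * s x) (\<phi> a)" for a
    unfolding acts_def
  proof
    fix f assume f: "f \<in> D"
    show "\<forall>\<^sub>F x in generic. f (\<phi> a x) = f x * (1 + a * s x) ^ \<nu> f"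
      using generic_orbit by eventually_elim (use \<nu>_orbit[OF f] in auto)
  qed
  \<comment> \<open>At the parameter \<open>1 / s x0\<close> the value of \<open>h\<close> doubles
    and that of \<open>q\<close> is unchanged.\<close>
  moreover have "\<nu> h = 1" "\<nu> q = 0"
    using nz by (auto intro!: \<nu>_unique D simp: h_\<phi>[OF x0_in] q_\<phi>[OF x0_in] s_def)
  moreover have "\<exists>f'\<in>D. \<forall>x\<in>X. f' x * h x ^ k = f x * q x ^ k" if f: "f \<in> D" and k: "k \<le> \<nu> f" for f k
  proof -
    obtain \<psi> where \<psi>: "semi_invariant \<psi> f"
      using f by (auto simp: D_def)
    obtain r N where r: "expands f r N"
      using expansion[OF D_P[OF f]] by blast
    define c where "c = (of_nat (\<nu> f choose k) :: 'a)"
    have c: "c \<noteq> 0"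
      using k by (simp add: c_def)
    \<comment> \<open>The \<open>k\<close>-th coefficient of the action on \<open>f\<close>, divided
      by the binomial coefficient, equals \<open>f * s ^ k\<close> on the open orbit.\<close>
    define f' where "f' x = 1 / c * coeff (r x) k" for x
    have f'_orbit: "f' (\<tau> t x0) = f (\<tau> t x0) * s (\<tau> t x0) ^ k" if t: "t \<in> T" for t
    proof -
      let ?x = "\<tau> t x0"
      have "poly (r ?x) a = poly (smult (f ?x) ([:1, s ?x:] ^ \<nu> f)) a" for a
        using expandsD(3)[OF r \<tau>_in[OF t x0_in], of a] \<nu>_orbit[OF f t, of a] by simp
      then have "r ?x = smult (f ?x) ([:1, s ?x:] ^ \<nu> f)"
        by (simp only: poly_eq_poly_eq_iff[symmetric] fun_eq_iff simp_thms)
      then show ?thesis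
        using c k by (simp add: f'_def c_def coeff_linear_poly_power)
    qed
    have "semi_invariant (\<lambda>t. \<psi> t / weight t ^ k) f'"
      using coeff_semi_invariant[OF \<psi> r, of k] mult_P[OF const_P expandsD(1)[OF r], of "1 / c" k]
      unfolding semi_invariant_def f'_def by auto
    moreover have "f' x0 \<noteq> 0"
      using f'_orbit[OF T.one_closed] \<tau>_one[OF x0_in] f nz(3) by (auto simp: D_def)
    ultimately have f': "f' \<in> D"
      by (auto simp: D_def)
    have "f' x * h x ^ k = f x * q x ^ k" if "x \<in> X" for x
    proof (rule generic_eq[OF _ _ _ that])
      show "\<forall>\<^sub>F x in generic. f' x * h x ^ k = f x * q x ^ k"
        using generic_orbit D_generic[OF D(1)]
      proof eventually_elim
        case (elim x)
        then obtain t where "t \<in> T" "x = \<tau> t x0"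
          by blast
        with elim(2) show ?case
          by (simp add: f'_orbit s_def power_divide)
      qed
    qed (intro mult_P power_P D_P f f' D)+
    with f' show ?thesis
      by blast
  qed
  ultimately have "is_root R"
    using D \<phi>_K by (auto simp: is_root_def slope_R) (auto simp: R_def)
  then show ?thesis
    by (auto simp: R_def)
qed

end

section \<open>From the geometric data to the abstract setting\<close>

text \<open>Fixing the parameter in a regular function on the product leaves a polynomial function
  on \<open>X\<close>, and the inverse map belongs to the opposite parameter.\<close>

lemma Ga_subgroup_subset:
  fixes X :: "(nat \<Rightarrow> 'k::field_char_0) set"
  assumes "affine_variety m X" "faithful_action Ga X \<phi>"
    and "regular_map (Ga_product_functions m) (UNIV \<times> X) m (\<lambda>(a, x). \<phi> a x)"
  shows "\<phi> a \<in> carrier (aut_group m X)"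
proof -
  interpret function_domain X "polynomial_functions m"
    by (rule function_domain_affine_variety[OF assms(1)])
  interpret faithful_action Ga X \<phi>
    by (rule assms(2))
  have bij: "\<phi> b \<in> Bij X" for b
    using group_hom.hom_closed[OF group_hom, of b] by (simp add: Ga_def BijGroup_def)
  have reg: "regular_map (polynomial_functions m) X m (\<phi> b)" for b
    unfolding regular_map_def
  proof (intro allI impI)
    fix j assume "j < m"
    then obtain p where p: "p \<in> Ga_product_functions m" "\<forall>y\<in>UNIV \<times> X. (case y of (a, x) \<Rightarrow> \<phi> a x) j = p y"
      using assms(3) unfolding regular_map_def by blast
    obtain r N where r: "\<forall>k. (\<lambda>x. coeff (r x) k) \<in> polynomial_functions m"
      "\<forall>x. degree (r x) \<le> N" "\<forall>a x. p (a, x) = poly (r x) a"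
      using Ga_product_expansion[OF p(1)] by blast
    have "p (b, x) = (\<Sum>i\<le>N. coeff (r x) i * b ^ i)" for x
    proof -
      have "p (b, x) = poly (\<Sum>i\<le>N. monom (coeff (r x) i) i) b"
        using r(2,3) by (simp add: poly_as_sum_of_monoms')
      then show ?thesis
        by (simp add: poly_sum poly_monom)
    qed
    moreover have "(\<lambda>x. \<Sum>i\<le>N. coeff (r x) i * b ^ i) \<in> polynomial_functions m"
      using r(1) by (intro sum_P mult_P const_P) auto
    ultimately show "\<exists>p\<in>polynomial_functions m. \<forall>x\<in>X. \<phi> b x j = p x"
      using p(2) by (intro bexI[of _ "\<lambda>x. \<Sum>i\<le>N. coeff (r x) i * b ^ i"]) auto
  qed
  have "inv_into X (\<phi> a) x = \<phi> (- a) x" if x: "x \<in> X" for x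
  proof (rule inv_into_f_eq)
    show "inj_on (\<phi> a) X"
      using bij[of a] by (simp add: Bij_def bij_betw_def)
    show "\<phi> (- a) x \<in> X"
      using Bij_imp_funcset[OF bij] x by blast
    have "\<phi> a (\<phi> (- a) x) = \<phi> 0 x"
      using composition_rule[OF x, of a "- a"] by (simp add: Ga_def)
    also have "\<dots> = x"
      using fun_cong[OF id_eq_one, of x] x by (simp add: Ga_def)
    finally show "\<phi> a (\<phi> (- a) x) = x" .
  qed
  then have "regular_map (polynomial_functions m) X m (inv_into X (\<phi> a))"
    using reg[of "- a"] by (simp add: regular_map_def)
  with bij reg show ?thesis
    by (simp add: aut_group_def)
qed

lemma normalizer_conjugate:
  fixes X :: "(nat \<Rightarrow> 'k::field) set"
  assumes "U \<subseteq> carrier (aut_group m X)" "g \<in> normalizer (aut_group m X) U" "u \<in> U"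
  shows "\<exists>v\<in>U. \<forall>x\<in>X. g (u x) = v (g x)"
proof -
  let ?A = "aut_group m X"
  interpret A: group ?A
    by (rule group_aut_group)
  have Bij: "f \<in> Bij X" if "f \<in> carrier ?A" for f
    using that by (simp add: aut_group_def)
  have g: "g \<in> carrier ?A" "g <#\<^bsub>?A\<^esub> U #>\<^bsub>?A\<^esub> inv\<^bsub>?A\<^esub> g = U"
    using assms(1,2) by (auto simp: normalizer_def stabilizer_def)
  have u: "u \<in> carrier ?A"
    using assms(1,3) by auto
  define v where "v = g \<otimes>\<^bsub>?A\<^esub> u \<otimes>\<^bsub>?A\<^esub> inv\<^bsub>?A\<^esub> g"
  have "v \<in> U"
    using g(2) assms(3) unfolding v_def l_coset_def r_coset_def by blast
  have "v \<otimes>\<^bsub>?A\<^esub> g = g \<otimes>\<^bsub>?A\<^esub> u"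
    unfolding v_def using g(1) u by (simp add: A.m_assoc)
  moreover have "f \<otimes>\<^bsub>?A\<^esub> f' = compose X f f'" if "f \<in> carrier ?A" "f' \<in> carrier ?A" for f f'
    using Bij[OF that(1)] Bij[OF that(2)] by (simp add: aut_group_def BijGroup_def)
  ultimately have "compose X v g = compose X g u"
    using g(1) u \<open>v \<in> U\<close> assms(1) by auto
  then have "g (u x) = v (g x)" if "x \<in> X" for x
    using that by (metis compose_eq)
  with \<open>v \<in> U\<close> show ?thesis
    by blast
qed

theorem corollary1p2:
  fixes X :: "(nat \<Rightarrow> 'k::{alg_closed_field, field_char_0}) set"
    and \<tau> :: "(nat \<Rightarrow> 'k) \<Rightarrow> (nat \<Rightarrow> 'k) \<Rightarrow> (nat \<Rightarrow> 'k)"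
    and U :: "nat \<Rightarrow> ((nat \<Rightarrow> 'k) \<Rightarrow> (nat \<Rightarrow> 'k)) set"
    and G :: "((nat \<Rightarrow> 'k) \<Rightarrow> (nat \<Rightarrow> 'k)) monoid"
    and Orb :: "(nat \<Rightarrow> 'k) set"
    and m n s :: nat
  assumes toric: "toric_variety n m X \<tau>"
    and normal: "normal_variety m X"
    and unipotent: "\<And>i. i \<in> {1..s} \<Longrightarrow> Ga_subgroup m X (U i)"
    and normalized: "\<And>i. i \<in> {1..s} \<Longrightarrow>
      \<tau> ` carrier (torus n) \<subseteq> normalizer (aut_group m X) (U i)"
    and generated: "G = subgroup_generated (aut_group m X) (\<Union>i\<in>{1..s}. U i)"
    and orbit: "Orb \<in> orbits G X (\<lambda>g. g)"
    and two_transitive: "doubly_transitive G (\<lambda>g. g) Orb"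
  shows "\<exists>H. subgroup H G \<and> free_group_of_rank (G\<lparr>carrier := H\<rparr>) 2"
proof -
  let ?A = "aut_group m X"
  define K where "K = carrier G"
  obtain x0 where x0: "x0 \<in> X" "zariski_closed m (X - orbit (torus n) \<tau> x0)"
    using toric by (auto simp: toric_variety_def)
  have variety: "affine_variety m X"
    using toric by (simp add: toric_variety_def)
  have "\<forall>i\<in>{1..s}. \<exists>\<phi>. faithful_action Ga X \<phi> \<and>
      regular_map (Ga_product_functions m) (UNIV \<times> X) m (\<lambda>(a, x). \<phi> a x) \<and> U i = range \<phi>"
    using unipotent by (auto simp: Ga_subgroup_def Ga_def)
  then obtain \<phi> where \<phi>: "\<And>i. i \<in> {1..s} \<Longrightarrow> faithful_action Ga X (\<phi> i)"
    "\<And>i. i \<in> {1..s} \<Longrightarrow> regular_map (Ga_product_functions m) (UNIV \<times> X) m (\<lambda>(a, x). \<phi> i a x)"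
    "\<And>i. i \<in> {1..s} \<Longrightarrow> U i = range (\<phi> i)"
    by metis
  have U_aut: "U i \<subseteq> carrier ?A" if "i \<in> {1..s}" for i
    using Ga_subgroup_subset[OF variety \<phi>(1,2)[OF that]] \<phi>(3)[OF that] by auto
  have subset: "(\<Union>i\<in>{1..s}. U i) \<subseteq> carrier ?A"
    using U_aut by (rule UN_least)
  have "K = generate ?A (\<Union>i\<in>{1..s}. U i)"
    using subset by (simp add: K_def generated carrier_subgroup_generated Int_absorb1)
  also have "\<dots> = generate (BijGroup X) (\<Union>i\<in>{1..s}. U i)"
    by (subst aut_group_eq) (rule group.generate_consistent[OF group_BijGroup subset subgroup_aut_group])
  finally have K: "K = generate (BijGroup X) (\<Union>i\<in>{1..s}. U i)" .
  have G: "G = BijGroup X\<lparr>carrier := K\<rparr>"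
    unfolding K_def generated subgroup_generated_def aut_group_def by simp
  interpret toric_group n m X \<tau> x0 K
  proof (rule toric_group.intro)
    show "toric n m X \<tau> x0"
      using toric x0 unfolding toric_variety_def toric_def by (auto dest: faithful_action.axioms)
    have "subgroup K (BijGroup X)"
      unfolding K using subset subgroup.subset[OF subgroup_aut_group]
      by (intro group.generate_is_subgroup[OF group_BijGroup]) blast
    moreover have "K \<subseteq> carrier ?A"
      unfolding K_def generated carrier_subgroup_generated
      by (rule group.generate_incl[OF group_aut_group]) simp
    ultimately show "toric_group_axioms m X K"
      by (rule toric_group_axioms.intro)
  qed
  have U_K: "\<phi> i a \<in> K" if "i \<in> {1..s}" for i a
    unfolding K using \<phi>(3)[OF that] that by (intro generate.incl) blast
  have "\<exists>r. is_root r \<and> grp r = \<phi> i" if i: "i \<in> {1..s}" for i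
  proof -
    interpret normalized_Ga n m X \<tau> x0 K "\<phi> i"
    proof (rule normalized_Ga.intro[OF toric_group_axioms normalized_Ga_axioms.intro])
      show "faithful_action Ga X (\<phi> i)"
        "regular_map (Ga_product_functions m) (UNIV \<times> X) m (\<lambda>(a, x). \<phi> i a x)"
        using \<phi>(1,2) i by auto
      show "\<phi> i a \<in> K" for a
        by (rule U_K[OF i])
      show "\<exists>b. \<forall>x\<in>X. \<tau> t (\<phi> i a x) = \<phi> i b (\<tau> t x)" if "t \<in> carrier (torus n)" for t a
        using normalizer_conjugate[OF U_aut[OF i], of "\<tau> t" "\<phi> i a"] normalized[OF i] that \<phi>(3)[OF i] by auto
    qed
    show ?thesis
      by (rule exists_root)
  qed
  then obtain R where R: "\<And>i. i \<in> {1..s} \<Longrightarrow> is_root (R i)" "\<And>i. i \<in> {1..s} \<Longrightarrow> grp (R i) = \<phi> i"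
    by metis
  show ?thesis
  \<comment> \<open>The alternative runs over all roots realised in \<open>K\<close>, so its failure
    also excludes mutual positivity for iterated commutators of the \<open>R i\<close>.\<close>
  proof (cases "\<exists>r r'. is_root r \<and> is_root r' \<and> pairing r r' > 0 \<and> pairing r' r > 0")
    case True
    then show ?thesis
      unfolding G using free_pair by blast
  next
    case False
    then have acyclic: "acyclic {(i, j) \<in> {1..s} \<times> {1..s}. pairing (R i) (R j) > 0}"
      by (intro acyclic_pairing R(1)) (meson not_le)+
    obtain y where y: "y \<in> X" "Orb = {g y | g. g \<in> K}"
      using orbit by (auto simp: orbits_def orbit_def K_def)
    obtain a b where ab: "a \<in> Orb" "b \<in> Orb" "a \<noteq> b"
      using two_transitive by (auto simp: doubly_transitive_def)
    have False
    proof (rule acyclic_not_doubly_transitive[OF _ R(1) _ acyclic _ _ ab])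
      show "K = generate (BijGroup X) (\<Union>i\<in>{1..s}. range (grp (R i)))"
        unfolding K using R(2) \<phi>(3) by simp
      show "Orb \<subseteq> X"
        using y K_in by auto
      show "g x \<in> Orb" if "g \<in> K" "x \<in> Orb" for g x
      proof -
        obtain g' where "g' \<in> K" "x = g' y"
          using \<open>x \<in> Orb\<close> y(2) by auto
        then show ?thesis
          using K_compose[OF \<open>g \<in> K\<close>, of g'] y compose_eq[OF y(1), of g g'] by auto
      qed
      \<comment> \<open>Double transitivity carries the pair \<open>(x, z)\<close> to
        \<open>(z, x)\<close>.\<close>
      show "\<exists>g\<in>K. g x = z \<and> g z = x" if "x \<in> Orb" "z \<in> Orb" "x \<noteq> z" for x z
        using two_transitive that unfolding doubly_transitive_def K_def by metis
    qed auto
    then show ?thesis ..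
  qed
qed

end
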